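(* For a rooted tree with $n$ placement chunks (nodes), a profit $p(b)$ for each node $b$, and a budget $k$, a maximum-profit parent-closed placement, i.e. a parent-closed set $T$ of nodes with $|T|\le k$ maximizing $\sum_{b\in T}p(b)$, can be computed exactly in $O(nk)$ time and $O(nk)$ memory.
   Context: A set $T$ of nodes is parent-closed if whenever a node is in $T$, every ancestor of that node (among the $n$ chunks) is in $T$. The tree may additionally have an always-present dummy root that carries no profit, is not among the $n$ chunks and does not consume budget (so that the $n$ chunks may form a rooted forest). Profits are real numbers, the budget $k$ is a positive integer, and running time and memory are measured in the unit-cost model, in which an arithmetic operation or comparison on profits takes $O(1)$ time and a number takes $O(1)$ memory. *)

theory Defs
  imports Complex_Main
begin

section \<open>Parent-closed placements in a rooted forest\<close>

text \<open>
  The chunks are the numbers below \<open>n\<close>, numbered in no particular order, and \<open>par v\<close> is the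
  parent of chunk \<open>v\<close>.  \<open>par v = None\<close> says that no chunk is the parent of \<open>v\<close>: either \<open>v\<close> is the
  root, or its parent is the dummy root.  So a rooted tree of chunks is the case of exactly one
  \<open>None\<close>, and a tree with a dummy root is the general case.
\<close>

definition child_rel :: "nat \<Rightarrow> (nat \<Rightarrow> nat option) \<Rightarrow> (nat \<times> nat) set" where
  "child_rel n par = {(u, v). v < n \<and> par v = Some u}"

definition rooted_forest :: "nat \<Rightarrow> (nat \<Rightarrow> nat option) \<Rightarrow> bool" where
  "rooted_forest n par \<longleftrightarrow>
     (\<forall>v u. v < n \<and> par v = Some u \<longrightarrow> u < n) \<and> acyclic (child_rel n par)"

definition ancestor :: "nat \<Rightarrow> (nat \<Rightarrow> nat option) \<Rightarrow> nat \<Rightarrow> nat \<Rightarrow> bool" where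
  "ancestor n par u v \<longleftrightarrow> (u, v) \<in> (child_rel n par)\<^sup>+"

definition parent_closed :: "nat \<Rightarrow> (nat \<Rightarrow> nat option) \<Rightarrow> nat set \<Rightarrow> bool" where
  "parent_closed n par T \<longleftrightarrow>
     T \<subseteq> {..<n} \<and> (\<forall>v\<in>T. \<forall>u. ancestor n par u v \<longrightarrow> u \<in> T)"

definition max_profit_placement ::
  "nat \<Rightarrow> (nat \<Rightarrow> nat option) \<Rightarrow> (nat \<Rightarrow> real) \<Rightarrow> nat \<Rightarrow> nat set \<Rightarrow> bool" where
  "max_profit_placement n par p k T \<longleftrightarrow>
     parent_closed n par T \<and> card T \<le> k \<and>
     (\<forall>T'. parent_closed n par T' \<and> card T' \<le> k \<longrightarrow> (\<Sum>b\<in>T'. p b) \<le> (\<Sum>b\<in>T. p b))"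


section \<open>A unit-cost random access machine with real numbers\<close>

text \<open>
  The machine has integer and real registers, addressed directly, and one integer and one real
  memory, addressed through integer registers.  A program mentions only finitely many registers.
  There is no rounding: real values influence integer values only through comparisons.  The real
  constants available to a program are the natural numbers, so none can carry hidden information.
\<close>

type_synonym reg = nat

record state =
  ireg :: "reg \<Rightarrow> nat"
  rreg :: "reg \<Rightarrow> real"
  imem :: "nat \<Rightarrow> nat"
  rmem :: "nat \<Rightarrow> real"

datatype iop = IAdd | ISub | IMul

datatype rop = RAdd | RSub | RMul | RDiv

datatype instr =
    IConst reg nat
  | IMove reg reg
  | IOp iop reg reg reg
  | ILoad reg reg
  | IStore reg reg
  | RConst reg nat
  | RMove reg reg
  | ROp rop reg reg reg
  | RLoad reg reg
  | RStore reg reg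

datatype test = ILess reg reg | IEq reg reg | RLess reg reg

datatype prog =
    Instr instr
  | Seq prog prog
  | If test prog prog
  | While test prog

fun iop_val :: "iop \<Rightarrow> nat \<Rightarrow> nat \<Rightarrow> nat" where
  "iop_val IAdd x y = x + y"
| "iop_val ISub x y = x - y"
| "iop_val IMul x y = x * y"

fun rop_val :: "rop \<Rightarrow> real \<Rightarrow> real \<Rightarrow> real" where
  "rop_val RAdd x y = x + y"
| "rop_val RSub x y = x - y"
| "rop_val RMul x y = x * y"
| "rop_val RDiv x y = x / y"

fun test_val :: "test \<Rightarrow> state \<Rightarrow> bool" where
  "test_val (ILess a b) s \<longleftrightarrow> ireg s a < ireg s b"
| "test_val (IEq a b) s \<longleftrightarrow> ireg s a = ireg s b"
| "test_val (RLess a b) s \<longleftrightarrow> rreg s a < rreg s b"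

text \<open>
  \<open>exec M i s\<close> executes one instruction on a machine with \<open>M\<close> integer and \<open>M\<close> real memory cells.
  An access outside the memory fails, and so does producing an integer outside \<open>{..<M}\<close>.  The
  latter means that an integer cell is just wide enough to hold an address; otherwise a single
  integer could store a whole array, and counting cells would not measure memory.  In all
  instructions the first register is the destination, except in the two stores, where it holds
  the destination address.
\<close>

fun exec :: "nat \<Rightarrow> instr \<Rightarrow> state \<Rightarrow> state option" where
  "exec M (IConst d c) s =
     (if c < M then Some (s\<lparr>ireg := (ireg s)(d := c)\<rparr>) else None)"
| "exec M (IMove d a) s = Some (s\<lparr>ireg := (ireg s)(d := ireg s a)\<rparr>)"
| "exec M (IOp f d a b) s =
     (let v = iop_val f (ireg s a) (ireg s b)
      in if v < M then Some (s\<lparr>ireg := (ireg s)(d := v)\<rparr>) else None)"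
| "exec M (ILoad d a) s =
     (if ireg s a < M then Some (s\<lparr>ireg := (ireg s)(d := imem s (ireg s a))\<rparr>) else None)"
| "exec M (IStore a b) s =
     (if ireg s a < M then Some (s\<lparr>imem := (imem s)(ireg s a := ireg s b)\<rparr>) else None)"
| "exec M (RConst d c) s = Some (s\<lparr>rreg := (rreg s)(d := real c)\<rparr>)"
| "exec M (RMove d a) s = Some (s\<lparr>rreg := (rreg s)(d := rreg s a)\<rparr>)"
| "exec M (ROp f d a b) s =
     Some (s\<lparr>rreg := (rreg s)(d := rop_val f (rreg s a) (rreg s b))\<rparr>)"
| "exec M (RLoad d a) s =
     (if ireg s a < M then Some (s\<lparr>rreg := (rreg s)(d := rmem s (ireg s a))\<rparr>) else None)"
| "exec M (RStore a b) s =
     (if ireg s a < M then Some (s\<lparr>rmem := (rmem s)(ireg s a := rreg s b)\<rparr>) else None)"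

text \<open>
  \<open>runs M c s t s'\<close>: started in \<open>s\<close> on a machine with \<open>M\<close> integer and \<open>M\<close> real memory cells, \<open>c\<close>
  halts in \<open>s'\<close> without failing, after executing exactly \<open>t\<close> instructions and tests.
\<close>

inductive runs :: "nat \<Rightarrow> prog \<Rightarrow> state \<Rightarrow> nat \<Rightarrow> state \<Rightarrow> bool" for M where
  Instr: "exec M i s = Some s' \<Longrightarrow> runs M (Instr i) s 1 s'"
| Seq: "runs M c1 s t1 s1 \<Longrightarrow> runs M c2 s1 t2 s2 \<Longrightarrow> runs M (Seq c1 c2) s (t1 + t2) s2"
| IfTrue: "test_val b s \<Longrightarrow> runs M c1 s t s' \<Longrightarrow> runs M (If b c1 c2) s (1 + t) s'"
| IfFalse: "\<not> test_val b s \<Longrightarrow> runs M c2 s t s' \<Longrightarrow> runs M (If b c1 c2) s (1 + t) s'"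
| WhileFalse: "\<not> test_val b s \<Longrightarrow> runs M (While b c) s 1 s"
| WhileTrue: "test_val b s \<Longrightarrow> runs M c s t1 s1 \<Longrightarrow> runs M (While b c) s1 t2 s2 \<Longrightarrow>
    runs M (While b c) s (1 + t1 + t2) s2"

lemma runs_deterministic:
  "runs M c s t s' \<Longrightarrow> runs M c s u s'' \<Longrightarrow> u = t \<and> s'' = s'"
proof (induction arbitrary: u s'' rule: runs.induct)
  case (Seq c1 s t1 s1 c2 t2 s2)
  from Seq.prems show ?case by cases (use Seq.IH in blast)
next
  case (WhileTrue b s c t1 s1 t2 s2)
  from WhileTrue.prems show ?case
    by cases (use WhileTrue.IH WhileTrue.hyps in \<open>blast+\<close>)
qed (erule runs.cases; force)+


section \<open>Input and output\<close>

text \<open>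
  The input is \<open>n\<close> and \<open>k\<close> in integer registers 0 and 1, the parent array (with \<open>n\<close> for a missing
  parent) in the first \<open>n\<close> integer cells and the profits in the first \<open>n\<close> real cells; everything
  else is zero.  The output is a 0/1 array in the first \<open>n\<close> integer cells.
\<close>

definition input_state ::
  "nat \<Rightarrow> (nat \<Rightarrow> nat option) \<Rightarrow> (nat \<Rightarrow> real) \<Rightarrow> nat \<Rightarrow> state" where
  "input_state n par p k =
     \<lparr>ireg = (\<lambda>_. 0)(0 := n, 1 := k),
      rreg = (\<lambda>_. 0),
      imem = (\<lambda>i. if i < n then (case par i of None \<Rightarrow> n | Some u \<Rightarrow> u) else 0),
      rmem = (\<lambda>i. if i < n then p i else 0)\<rparr>"

definition represents_set :: "nat \<Rightarrow> state \<Rightarrow> nat set \<Rightarrow> bool" where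
  "represents_set n s T \<longleftrightarrow>
     T \<subseteq> {..<n} \<and> (\<forall>i<n. imem s i = (if i \<in> T then 1 else 0))"

end

theory Submission
  imports Defs
begin

text \<open>
  Number the nodes in preorder as \<open>v\<^sub>1, \<dots>, v\<^sub>n\<close> and let \<open>v\<^sub>s\<close> be the first node after
  the subtree of \<open>v\<^sub>i\<close>.  Let \<open>opt i j\<close> be the best profit of at most \<open>j\<close> nodes among
  \<open>v\<^sub>i, \<dots>, v\<^sub>n\<close> that contain the parent of each of their members whenever that parent is itself
  among \<open>v\<^sub>i, \<dots>, v\<^sub>n\<close>.  Either \<open>v\<^sub>i\<close> is taken, which leaves the same problem for
  \<open>v\<^sub>i\<^sub>+\<^sub>1\<close> and budget \<open>j - 1\<close>, or its whole subtree is given up, so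
  \<open>opt i j = max (opt (i + 1) (j - 1) + p v\<^sub>i) (opt s j)\<close>: a table with \<open>O(nk)\<close> entries and
  constant work for each.  The preorder itself costs \<open>O(n)\<close>: the successor of a node is one of its
  children or, if there are none, the node after its subtree, and the latter is the next sibling or
  else the node after the subtree of the parent.
\<close>

section \<open>Preorder\<close>

locale chunk_forest =
  fixes n :: nat and par :: "nat \<Rightarrow> nat option"
  assumes forest: "rooted_forest n par"
begin

text \<open>Same encoding as in the input array: \<open>n\<close> stands for a missing parent and
  thereby becomes the dummy root.\<close>

definition parent :: "nat \<Rightarrow> nat" where
  "parent v = (case par v of None \<Rightarrow> n | Some u \<Rightarrow> u)"

lemma parent_le: "v < n \<Longrightarrow> parent v \<le> n"
  using forest by (force simp: parent_def rooted_forest_def split: option.splits)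

text \<open>The dummy root \<open>n\<close> becomes an ordinary root, which turns the forest into a tree.\<close>

definition edge :: "(nat \<times> nat) set" where
  "edge = {(parent v, v) | v. v < n}"

lemma edge_iff: "(u, v) \<in> edge \<longleftrightarrow> v < n \<and> u = parent v"
  by (auto simp: edge_def)

lemma child_rel_subset: "child_rel n par \<subseteq> edge"
  by (auto simp: child_rel_def edge_def parent_def)

lemma edge_cases: "(u, v) \<in> edge \<Longrightarrow> u = n \<or> (u, v) \<in> child_rel n par"
  by (auto simp: child_rel_def edge_def parent_def split: option.splits)

lemma finite_edge: "finite edge"
proof -
  have "edge = (\<lambda>v. (parent v, v)) ` {..<n}" by (auto simp: edge_def)
  then show ?thesis by simp
qed

text \<open>\<open>child_rel\<close> is finite and acyclic, hence well-founded. The additional edges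
  all leave \<open>n\<close>, which is minimal because every edge ends below
  \<open>n\<close>.\<close>

lemma wf_edge: "wf edge"
proof (rule wfUNIVI)
  fix Q x
  assume step: "\<forall>x. (\<forall>y. (y, x) \<in> edge \<longrightarrow> Q y) \<longrightarrow> Q x"
  have "finite (child_rel n par)"
    using child_rel_subset finite_edge by (rule finite_subset)
  then have wf: "wf (child_rel n par)"
    using forest by (simp add: finite_acyclic_wf rooted_forest_def)
  have Qn: "Q n" using step by (auto simp: edge_iff)
  show "Q x"
    using wf
  proof (induction x rule: wf_induct_rule)
    case (less x)
    then show ?case using step Qn edge_cases by blast
  qed
qed

text \<open>Allows induction from the leaves upwards, where a claim about \<open>v\<close> may use
  the claim for its children.\<close>

lemma wf_edge_converse: "wf (edge\<inverse>)"
  using finite_edge wf_acyclic[OF wf_edge] by (rule finite_acyclic_wf_converse)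

lemma trancl_edge_less: "(u, v) \<in> edge\<^sup>+ \<Longrightarrow> v < n"
  by (induction rule: trancl.induct) (auto simp: edge_iff)

lemma root_trancl_edge: "v < n \<Longrightarrow> (n, v) \<in> edge\<^sup>+"
  using wf_edge
proof (induction v rule: wf_induct_rule)
  case (less v)
  have e: "(parent v, v) \<in> edge" using less.prems by (simp add: edge_iff)
  show ?case
  proof (cases "parent v = n")
    case True
    then show ?thesis using e by auto
  next
    case False
    then have "(n, parent v) \<in> edge\<^sup>+"
      using less.IH[OF e] parent_le[OF less.prems] by simp
    then show ?thesis using e by (rule trancl_into_trancl)
  qed
qed

text \<open>
  The children of \<open>u\<close> are visited in decreasing order, and \<open>n\<close> encodes absence, so
  \<open>last_child v (parent v)\<close> is the sibling that follows \<open>v\<close>.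
\<close>

primrec last_child :: "nat \<Rightarrow> nat \<Rightarrow> nat" where
  "last_child 0 u = n"
| "last_child (Suc i) u = (if parent i = u then i else last_child i u)"

lemma last_child_le: "i \<le> n \<Longrightarrow> last_child i u \<le> n"
  by (induction i) auto

text \<open>The preorder node after the whole subtree of \<open>v\<close>. Each recursive call
  climbs one edge towards the dummy root, whose value \<open>n\<close> closes the traversal into a
  cycle.\<close>

function skip :: "nat \<Rightarrow> nat" where
  "skip v = (if v < n then
      let w = last_child v (parent v) in if w = n then skip (parent v) else w
    else n)"
  by auto
termination by (relation edge) (auto simp: wf_edge edge_iff)

declare skip.simps [simp del]

text \<open>The preorder successor; siblings come in decreasing order, so the greatest child is
  entered first.\<close>

definition first :: "nat \<Rightarrow> nat" where
  "first v = (if last_child n v = n then skip v else last_child n v)"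

lemma skip_root: "skip n = n"
  by (simp add: skip.simps)

lemma skip_eq: "v < n \<Longrightarrow>
    skip v = (let w = last_child v (parent v) in if w = n then skip (parent v) else w)"
  by (subst skip.simps) simp

lemma first_root: "first n = last_child n n"
  by (simp add: first_def skip_root)

text \<open>
  Injectivity of the run need not be tracked here: a repetition would keep the run from ever
  reaching the dummy root (see \<open>no_return\<close> below).
\<close>

lemma first_run:
  "\<exists>m. (first ^^ m) (first v) = skip v \<and>
       (\<lambda>q. (first ^^ q) (first v)) ` {..<m} = {w. (v, w) \<in> edge\<^sup>+}"
  using wf_edge_converse
proof (induction v rule: wf_induct_rule)
  case (less v)
  \<comment> \<open>\<open>start i\<close> is where the traversal below \<open>v\<close> stands once
    the subtrees of all children \<ge> \<open>i\<close> are done. The inner induction on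
    \<open>i\<close> covers the subtrees of the children below \<open>i\<close>;
    \<open>i = n\<close> gives \<open>first v\<close>.\<close>
  define start where "start i = (if last_child i v = n then skip v else last_child i v)" for i
  have "\<exists>m. (first ^^ m) (start i) = skip v \<and>
       (\<lambda>q. (first ^^ q) (start i)) ` {..<m} =
       {w. \<exists>c<i. parent c = v \<and> (c, w) \<in> edge\<^sup>*}" if "i \<le> n" for i
    using that
  proof (induction i)
    case 0
    then show ?case by (auto simp: start_def intro: exI[of _ 0])
  next
    case (Suc i)
    then have i: "i < n" by simp
    obtain m where m: "(first ^^ m) (start i) = skip v"
      "(\<lambda>q. (first ^^ q) (start i)) ` {..<m} = {w. \<exists>c<i. parent c = v \<and> (c, w) \<in> edge\<^sup>*}"
      using Suc by auto
    show ?case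
    proof (cases "parent i = v")
      case False
      then have "start (Suc i) = start i" by (simp add: start_def)
      moreover have "{w. \<exists>c<Suc i. parent c = v \<and> (c, w) \<in> edge\<^sup>*} =
          {w. \<exists>c<i. parent c = v \<and> (c, w) \<in> edge\<^sup>*}"
        using False less_Suc_eq by auto
      ultimately show ?thesis using m by metis
    next
      case True
      have s: "start (Suc i) = i" using True i by (simp add: start_def)
      \<comment> \<open>The sibling after \<open>i\<close> is the greatest child of \<open>v\<close>
        below \<open>i\<close>, so the traversal leaves the subtree of \<open>i\<close> exactly at
        \<open>start i\<close>.\<close>
      have sk: "skip i = start i" using i True by (simp add: skip_eq start_def Let_def)
      obtain l where l: "(first ^^ l) (first i) = skip i"
        "(\<lambda>q. (first ^^ q) (first i)) ` {..<l} = {w. (i, w) \<in> edge\<^sup>+}"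
        using less.IH[of i] i True by (auto simp: edge_iff)
      let ?r = "\<lambda>q. (first ^^ q) i"
      have r1: "?r (Suc q) = (first ^^ q) (first i)" for q
        by (simp add: funpow_swap1)
      have r2: "?r (Suc l + q) = (first ^^ q) (start i)" for q
      proof -
        have "?r (Suc l + q) = (first ^^ q) (?r (Suc l))"
          by (simp only: add.commute[of "Suc l"] funpow_add comp_apply)
        then show ?thesis by (simp only: r1 l(1) sk)
      qed
      \<comment> \<open>Position 0 is \<open>i\<close> itself, the next \<open>l\<close> are its
        proper descendants (outer induction hypothesis), the last \<open>m\<close> the subtrees of
        the smaller siblings (inner one).\<close>
      have "x \<in> {0} \<union> Suc ` {..<l} \<union> (\<lambda>q. Suc l + q) ` {..<m}" if "x < Suc l + m" for x
      proof -
        consider "x = 0" | "0 < x" "x < Suc l" | "Suc l \<le> x" by linarith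
        then show ?thesis
        proof cases
          case 2
          then have "x \<in> Suc ` {..<l}" by (intro image_eqI[of _ _ "x - 1"]) auto
          then show ?thesis by blast
        next
          case 3
          then have "x \<in> (\<lambda>q. Suc l + q) ` {..<m}"
            using that by (intro image_eqI[of _ _ "x - Suc l"]) auto
          then show ?thesis by blast
        qed simp
      qed
      then have "{..<Suc l + m} = {0} \<union> Suc ` {..<l} \<union> (\<lambda>q. Suc l + q) ` {..<m}"
        by auto
      then have "?r ` {..<Suc l + m} = {i} \<union> (\<lambda>q. ?r (Suc q)) ` {..<l} \<union> (\<lambda>q. ?r (Suc l + q)) ` {..<m}"
        by (simp only: image_Un image_image) simp
      also have "\<dots> = {w. (i, w) \<in> edge\<^sup>*} \<union> {w. \<exists>c<i. parent c = v \<and> (c, w) \<in> edge\<^sup>*}"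
        by (simp only: r1 r2 l(2) m(2)) (auto simp: rtrancl_eq_or_trancl)
      also have "\<dots> = {w. \<exists>c<Suc i. parent c = v \<and> (c, w) \<in> edge\<^sup>*}"
        using True by (auto simp: less_Suc_eq)
      finally show ?thesis using m(1) r2[of m] by (intro exI[of _ "Suc l + m"]) (simp only: s simp_thms)
    qed
  qed
  from this[of n] obtain m where m: "(first ^^ m) (start n) = skip v"
     "(\<lambda>q. (first ^^ q) (start n)) ` {..<m} = {w. \<exists>c<n. parent c = v \<and> (c, w) \<in> edge\<^sup>*}"
    by auto
  have "{w. \<exists>c<n. parent c = v \<and> (c, w) \<in> edge\<^sup>*} = {w. (v, w) \<in> edge\<^sup>+}"
    by (auto simp: edge_iff dest!: tranclD intro: rtrancl_into_trancl2)
  moreover have "start n = first v" by (simp add: start_def first_def)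
  ultimately show ?case using m by auto
qed

text \<open>The run is cyclic: both position \<open>0\<close> and position \<open>n + 1\<close> are the dummy root.\<close>

definition ord :: "nat \<Rightarrow> nat" where
  "ord i = (first ^^ i) n"

lemma ord_0: "ord 0 = n"
  by (simp add: ord_def)

lemma ord_Suc: "ord (Suc i) = first (ord i)"
  by (simp add: ord_def)

text \<open>By \<open>first_run\<close> at the dummy root, the run covers all its proper
  descendants, which are the chunks, and comes back to \<open>n\<close>. Once injectivity is known,
  counting gives the length \<open>m = n\<close>.\<close>

lemma ord_bij: "bij_betw ord {0<..n} {..<n}" and ord_end: "ord (Suc n) = n"
proof -
  obtain m where m: "(first ^^ m) (first n) = n"
    "(\<lambda>q. (first ^^ q) (first n)) ` {..<m} = {w. (n, w) \<in> edge\<^sup>+}"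
    using first_run[of n] skip_root by auto
  have sw: "(first ^^ q) (first n) = ord (Suc q)" for q
    by (simp add: ord_def funpow_swap1)
  have "{w. (n, w) \<in> edge\<^sup>+} = {..<n}"
    using root_trancl_edge trancl_edge_less by auto
  moreover have "(\<lambda>q. ord (Suc q)) ` {..<m} = ord ` {0<..m}"
    by (simp add: image_image[symmetric] image_Suc_lessThan atLeastSucAtMost_greaterThanAtMost)
  ultimately have img: "ord ` {0<..m} = {..<n}" and last: "ord (Suc m) = n"
    using m by (auto simp: sw)
  \<comment> \<open>If positions \<open>i < j\<close> agree, the orbit has period
    \<open>d = j - i\<close> from \<open>i\<close> on. Reducing the offset \<open>e\<close> of the
    return position \<open>Suc m\<close> modulo \<open>d\<close> gives a position at least
    \<open>i\<close> and below \<open>j\<close> with value \<open>n\<close>, but values there lie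
    below \<open>n\<close>.\<close>
  have no_return: False if "0 < i" "i < j" "j \<le> m" "ord i = ord j" for i j
  proof -
    define d where "d = j - i"
    define e where "e = Suc m - i"
    have d: "0 < d" "j = d + i" "Suc m = e + i" using that by (auto simp: d_def e_def)
    have "(first ^^ d) (ord i) = ord i"
      using that(4) d(2) by (simp add: ord_def funpow_add)
    then have "(first ^^ (e mod d)) (ord i) = (first ^^ e) (ord i)"
      by (rule funpow_mod_eq)
    then have "ord (e mod d + i) = ord (e + i)"
      by (simp add: ord_def funpow_add)
    then have "ord (e mod d + i) = n" using last d by metis
    moreover have "e mod d + i \<in> {0<..m}"
      using mod_less_divisor[OF d(1), of e] that(1,3) unfolding d(2) greaterThanAtMost_iff by linarith
    ultimately have "n \<in> ord ` {0<..m}" by (metis imageI)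
    then show False by (simp add: img)
  qed
  then have inj: "inj_on ord {0<..m}"
    by (intro linorder_inj_onI') auto
  have "m = n" using card_image[OF inj] unfolding img by simp
  then show "bij_betw ord {0<..n} {..<n}" "ord (Suc n) = n"
    using bij_betw_imageI[OF inj img] last by simp_all
qed

section \<open>Positions of nodes, subtrees and parents\<close>

lemma ord_less: "0 < i \<Longrightarrow> i \<le> n \<Longrightarrow> ord i < n"
  using bij_betwE[OF ord_bij] by simp

lemma ord_le: "i \<le> Suc n \<Longrightarrow> ord i \<le> n"
  using ord_less[of i] ord_0 ord_end by (cases "i = 0"; cases "i = Suc n") auto

text \<open>Position \<open>Suc n\<close> is included because it is the base case of the recurrence;
  its value \<open>n\<close> is no chunk.\<close>

lemma inj_ord: "inj_on ord {0<..Suc n}"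
proof -
  have "{0<..Suc n} = insert (Suc n) {0<..n}" by auto
  moreover have "ord (Suc n) \<notin> ord ` {0<..n}"
    by (simp add: bij_betw_imp_surj_on[OF ord_bij] ord_end)
  then have "ord (Suc n) \<notin> ord ` ({0<..n} - {Suc n})" by blast
  ultimately show ?thesis
    using bij_betw_imp_inj_on[OF ord_bij] by (simp only: inj_on_insert simp_thms)
qed

lemma ord_eq_iff: "0 < i \<Longrightarrow> i \<le> Suc n \<Longrightarrow> 0 < j \<Longrightarrow> j \<le> Suc n \<Longrightarrow> ord i = ord j \<longleftrightarrow> i = j"
  using inj_on_eq_iff[OF inj_ord] by (simp only: greaterThanAtMost_iff simp_thms)

lemma ord_mem_iff:
  "0 < i \<Longrightarrow> i \<le> Suc n \<Longrightarrow> A \<subseteq> {0<..Suc n} \<Longrightarrow> ord i \<in> ord ` A \<longleftrightarrow> i \<in> A"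
  using inj_on_image_mem_iff[OF inj_ord] by (simp only: greaterThanAtMost_iff simp_thms)

lemma ord_surj:
  assumes "v < n"
  obtains i where "0 < i" "i \<le> n" "v = ord i"
proof -
  have "v \<in> ord ` {0<..n}" using assms by (simp add: bij_betw_imp_surj_on[OF ord_bij])
  then show ?thesis using that by auto
qed

text \<open>A subtree fills an interval of positions, since \<open>first_run\<close> visits the
  proper descendants right after the node.\<close>

lemma ord_skip:
  assumes "0 < i" "i \<le> n"
  obtains s where "i < s" "s \<le> Suc n" "ord s = skip (ord i)"
    "ord ` {i..<s} = {w. (ord i, w) \<in> edge\<^sup>*}"
proof -
  obtain m where m: "(first ^^ m) (first (ord i)) = skip (ord i)"
    "(\<lambda>q. (first ^^ q) (first (ord i))) ` {..<m} = {w. (ord i, w) \<in> edge\<^sup>+}"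
    using first_run by blast
  have sw: "(first ^^ q) (first (ord i)) = ord (Suc i + q)" for q
    by (simp add: ord_def funpow_add funpow_swap1 add.commute[of i])
  have "(\<lambda>q. ord (Suc i + q)) ` {..<m} = ord ` {Suc i..<Suc i + m}"
  proof -
    have "{Suc i..<Suc i + m} = (\<lambda>q. Suc i + q) ` {..<m}"
      unfolding lessThan_atLeast0 image_add_atLeastLessThan by (simp add: add.commute)
    then show ?thesis by (simp only: image_image)
  qed
  then have im: "ord ` {Suc i..<Suc i + m} = {w. (ord i, w) \<in> edge\<^sup>+}"
    and sk: "ord (Suc i + m) = skip (ord i)"
    using m by (auto simp: sw)
  \<comment> \<open>A longer run would visit position \<open>Suc n\<close> and make the dummy root a
    proper descendant, but no edge enters it.\<close>
  have "Suc i + m \<le> Suc n"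
  proof (rule ccontr)
    assume "\<not> ?thesis"
    then have "Suc n \<in> {Suc i..<Suc i + m}" using assms by auto
    then have "(ord i, n) \<in> edge\<^sup>+" using im ord_end by force
    then show False using trancl_edge_less by blast
  qed
  moreover have "ord ` {i..<Suc i + m} = {w. (ord i, w) \<in> edge\<^sup>*}"
  proof -
    have "{i..<Suc i + m} = insert i {Suc i..<Suc i + m}" by auto
    then show ?thesis using im by (auto simp: rtrancl_eq_or_trancl)
  qed
  ultimately show ?thesis using that[of "Suc i + m"] sk by simp
qed

text \<open>The subtree of a parent at position \<open>q\<close> is an interval that starts at
  \<open>q\<close> and contains \<open>i\<close>; the dummy root counts as position 0.\<close>

lemma ord_parent:
  assumes "0 < i" "i \<le> n"
  obtains q where "q < i" "parent (ord i) = ord q"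
proof -
  have v: "ord i < n" using assms by (rule ord_less)
  have e: "(parent (ord i), ord i) \<in> edge" using v by (simp add: edge_iff)
  show ?thesis
  proof (cases "parent (ord i) = n")
    case True
    then show ?thesis using that[of 0] assms ord_0 by simp
  next
    case False
    then have "parent (ord i) < n" using parent_le[OF v] by (rule le_neq_implies_less[rotated])
    then obtain q where q: "0 < q" "q \<le> n" "parent (ord i) = ord q"
      by (rule ord_surj)
    obtain s where s: "q < s" "s \<le> Suc n" "ord s = skip (ord q)"
        "ord ` {q..<s} = {w. (ord q, w) \<in> edge\<^sup>*}"
      by (rule ord_skip[OF q(1,2)])
    have "ord i \<in> ord ` {q..<s}" unfolding s(4) using e q(3) by auto
    moreover have "{q..<s} \<subseteq> {0<..Suc n}" using q(1) s(2) by auto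
    ultimately have "i \<in> {q..<s}" using ord_mem_iff assms by (metis le_SucI)
    then have "q \<le> i" by simp
    moreover have "q \<noteq> i" using e q(3) wf_edge by (auto simp: wf_irrefl)
    ultimately show ?thesis using that[of q] q(3) by simp
  qed
qed

text \<open>Here the dummy root has position 0 instead of \<open>Suc n\<close>; this form separates
  the cells of the successor and skip arrays.\<close>

lemma ord_eq_iff_atMost: "q \<le> n \<Longrightarrow> r \<le> n \<Longrightarrow> ord q = ord r \<longleftrightarrow> q = r"
proof -
  assume qr: "q \<le> n" "r \<le> n"
  have "ord 0 \<noteq> ord i" if "0 < i" "i \<le> n" for i
    using ord_less[OF that] by (simp add: ord_0)
  then show ?thesis
    using ord_eq_iff[of q r] qr by (cases "q = 0"; cases "r = 0") (simp_all, metis)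
qed

lemma skip_le: "v \<le> n \<Longrightarrow> skip v \<le> n"
  using wf_edge
proof (induction v rule: wf_induct_rule)
  case (less v)
  show ?case
  proof (cases "v < n")
    case True
    then show ?thesis
      using less.IH[of "parent v"] last_child_le[of v "parent v"] parent_le[OF True]
      by (simp add: skip_eq edge_iff Let_def)
  qed (use less.prems skip_root in simp)
qed

lemma first_le: "v \<le> n \<Longrightarrow> first v \<le> n"
  using skip_le last_child_le[of n v] by (simp add: first_def)

section \<open>The recurrence\<close>

definition feasible :: "nat \<Rightarrow> nat \<Rightarrow> nat set set" where
  "feasible i j = {T. T \<subseteq> ord ` {i..n} \<and> card T \<le> j \<and>
     (\<forall>v\<in>T. parent v \<in> ord ` {i..n} \<longrightarrow> parent v \<in> T)}"

lemma feasible_0: "feasible i 0 = {{}}"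
  by (auto simp: feasible_def dest: finite_subset)

lemma feasible_end: "feasible (Suc n) j = {{}}"
  by (auto simp: feasible_def)

lemma finite_feasible: "finite (feasible i j)"
  by (rule finite_subset[of _ "Pow (ord ` {i..n})"]) (auto simp: feasible_def)

lemma empty_feasible: "{} \<in> feasible i j"
  by (simp add: feasible_def)

text \<open>The parent of \<open>ord i\<close> sits at an earlier position, hence outside the
  suffix, so adding \<open>ord i\<close> brings no new requirement and satisfies that of its
  children.\<close>

lemma feasible_take:
  assumes "0 < i" "i \<le> n" and T: "T \<in> feasible (Suc i) j"
  shows "insert (ord i) T \<in> feasible i (Suc j)" "ord i \<notin> T" "finite T"
proof -
  have iv: "{i..n} = insert i {Suc i..n}" using assms(2) by auto
  have sub: "T \<subseteq> ord ` {Suc i..n}" using T by (simp add: feasible_def)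
  then show fin: "finite T" by (rule finite_subset) simp
  have "ord i \<notin> ord ` {Suc i..n}"
    using assms(1,2) by (subst ord_mem_iff) auto
  then show notin: "ord i \<notin> T" using sub by blast
  obtain q where q: "q < i" "parent (ord i) = ord q" using ord_parent assms by blast
  have "ord q \<notin> ord ` {i..n}"
  proof (cases "q = 0")
    case True
    have "x < n" if "x \<in> ord ` {i..n}" for x
      using that assms(1) by (auto intro!: ord_less)
    then show ?thesis unfolding True ord_0 by blast
  next
    case False
    then show ?thesis using q assms(1,2) by (subst ord_mem_iff) auto
  qed
  then show "insert (ord i) T \<in> feasible i (Suc j)"
    using T q fin notin by (auto simp: feasible_def iv)
qed

text \<open>Children of \<open>ord i\<close> lose their constraint because position \<open>i\<close>
  leaves the suffix.\<close>

lemma feasible_untake: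
  assumes "0 < i" "i \<le> n" and T: "T \<in> feasible i (Suc j)" "ord i \<in> T"
  shows "T - {ord i} \<in> feasible (Suc i) j"
proof -
  have iv: "{i..n} = insert i {Suc i..n}" using assms(2) by auto
  have fin: "finite T" using T by (auto simp: feasible_def intro: finite_subset)
  have "ord i \<notin> ord ` {Suc i..n}"
    using assms(1,2) by (subst ord_mem_iff) auto
  then show ?thesis using T fin by (auto simp: feasible_def iv)
qed

text \<open>Positions from \<open>i\<close> to before \<open>s\<close> are the subtree of
  \<open>ord i\<close>. Refusing its root refuses all descendants, and a node from \<open>s\<close>
  on never has its parent in that subtree, so dropping the interval changes no constraint.\<close>

lemma feasible_skip:
  assumes "0 < i" "i \<le> n" "0 < s" "s \<le> Suc n" and s: "ord s = skip (ord i)"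
  shows "feasible s j = {T \<in> feasible i j. ord i \<notin> T}"
proof -
  obtain r where r: "i < r" "r \<le> Suc n" "ord r = skip (ord i)"
    "ord ` {i..<r} = {w. (ord i, w) \<in> edge\<^sup>*}"
    using ord_skip assms by metis
  then have "s = r" using ord_eq_iff[of s r] assms by simp
  note r = r[folded this]
  have split: "ord ` {i..n} = ord ` {i..<s} \<union> ord ` {s..n}"
  proof -
    have "{i..n} = {i..<s} \<union> {s..n}" using r(1,2) by auto
    then show ?thesis by auto
  qed
  have disj: "ord ` {i..<s} \<inter> ord ` {s..n} = {}"
  proof -
    have "{i..<s} \<inter> {s..n} = {}" by auto
    moreover have "{i..<s} \<subseteq> {0<..Suc n}" "{s..n} \<subseteq> {0<..Suc n}" using assms r(1,2) by auto
    ultimately show ?thesis using inj_on_image_Int[OF inj_ord] by (metis image_empty)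
  qed
  show ?thesis
  proof (intro equalityI subsetI)
    fix T assume T: "T \<in> feasible s j"
    have "parent v \<notin> ord ` {i..<s}" if "v \<in> T" for v
    proof
      assume a: "parent v \<in> ord ` {i..<s}"
      have v: "v \<in> ord ` {s..n}" using that T by (auto simp: feasible_def)
      then have "(parent v, v) \<in> edge" using ord_less assms(3) by (auto simp: edge_iff)
      then have "v \<in> ord ` {i..<s}" using a unfolding r(4) by auto
      then show False using v disj by blast
    qed
    moreover have "ord i \<in> ord ` {i..<s}" using r(1) by simp
    then have "ord i \<notin> T" using T disj by (auto simp: feasible_def)
    ultimately show "T \<in> {T \<in> feasible i j. ord i \<notin> T}"
      using T by (auto simp: feasible_def split)
  next
    fix T assume "T \<in> {T \<in> feasible i j. ord i \<notin> T}"
    then have T: "T \<in> feasible i j" and nt: "ord i \<notin> T" by auto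
    have "w \<notin> T" if "(ord i, w) \<in> edge\<^sup>*" for w
      using that
    proof (induction rule: rtrancl_induct)
      case base
      then show ?case by (rule nt)
    next
      case (step v w)
      have "v \<in> ord ` {i..n}" using step.hyps(1) r(4) split by auto
      then show ?case using step T by (auto simp: feasible_def edge_iff)
    qed
    then have "T \<inter> ord ` {i..<s} = {}" unfolding r(4) by auto
    then show "T \<in> feasible s j" using T by (auto simp: feasible_def split)
  qed
qed

text \<open>Closure under ancestors reduces to closure under parents by induction along
  \<open>child_rel\<close>; the dummy root lies outside \<open>{..<n}\<close> and imposes
  nothing.\<close>

lemma feasible_1: "feasible (Suc 0) k = {T. parent_closed n par T \<and> card T \<le> k}"
proof -
  have im: "ord ` {0<..n} = {..<n}" using ord_bij by (auto simp: bij_betw_def)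
  have "parent_closed n par T \<longleftrightarrow> T \<subseteq> {..<n} \<and> (\<forall>v\<in>T. parent v < n \<longrightarrow> parent v \<in> T)" for T
  proof
    assume pc: "parent_closed n par T"
    have "parent v \<in> T" if "v \<in> T" "parent v < n" for v
    proof -
      have "v < n" using that pc by (auto simp: parent_closed_def)
      then have "(parent v, v) \<in> child_rel n par"
        using that edge_cases[of "parent v" v] by (auto simp: edge_iff)
      then show ?thesis using pc that by (auto simp: parent_closed_def ancestor_def)
    qed
    then show "T \<subseteq> {..<n} \<and> (\<forall>v\<in>T. parent v < n \<longrightarrow> parent v \<in> T)"
      using pc by (auto simp: parent_closed_def)
  next
    assume T: "T \<subseteq> {..<n} \<and> (\<forall>v\<in>T. parent v < n \<longrightarrow> parent v \<in> T)"
    have "v \<in> T \<longrightarrow> u \<in> T" if "(u, v) \<in> (child_rel n par)\<^sup>+" for u v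
      using that
    proof (induction rule: trancl_induct)
      case (base v)
      then show ?case using T forest by (auto simp: child_rel_def parent_def rooted_forest_def)
    next
      case (step v w)
      then have "w \<in> T \<longrightarrow> v \<in> T"
        using T forest by (auto simp: child_rel_def parent_def rooted_forest_def)
      then show ?case using step by blast
    qed
    then show "parent_closed n par T" using T by (auto simp: parent_closed_def ancestor_def)
  qed
  moreover have "{Suc 0..n} = {0<..n}" by auto
  ultimately show ?thesis unfolding feasible_def by (simp only: im) auto
qed

section \<open>Optimal profits of suffixes\<close>

definition opt :: "(nat \<Rightarrow> real) \<Rightarrow> nat \<Rightarrow> nat \<Rightarrow> real" where
  "opt p i j = Max (sum p ` feasible i j)"

lemma opt_0: "opt p i 0 = 0"
  by (simp add: opt_def feasible_0)

lemma opt_end: "opt p (Suc n) j = 0"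
  by (simp add: opt_def feasible_end)

lemma opt_ge: "T \<in> feasible i j \<Longrightarrow> sum p T \<le> opt p i j"
  by (simp add: opt_def finite_feasible)

lemma opt_attained: obtains T where "T \<in> feasible i j" "sum p T = opt p i j"
proof -
  have "opt p i j \<in> sum p ` feasible i j"
    unfolding opt_def using empty_feasible by (intro Max_in finite_imageI finite_feasible) auto
  then show ?thesis using that by auto
qed

text \<open>An optimal set for the left side passes to a subproblem by
  \<open>feasible_untake\<close> or \<open>feasible_skip\<close>; conversely, optimal sets of the
  subproblems extend by \<open>feasible_take\<close> or \<open>feasible_skip\<close>.\<close>

lemma opt_Suc:
  assumes i: "0 < i" "i \<le> n" and s: "0 < s" "s \<le> Suc n" "ord s = skip (ord i)"
  shows "opt p i (Suc j) = max (opt p (Suc i) j + p (ord i)) (opt p s (Suc j))"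
proof (rule antisym)
  obtain T where T: "T \<in> feasible i (Suc j)" "sum p T = opt p i (Suc j)"
    by (rule opt_attained)
  show "opt p i (Suc j) \<le> max (opt p (Suc i) j + p (ord i)) (opt p s (Suc j))"
  proof (cases "ord i \<in> T")
    case True
    have "finite T" using T by (auto simp: feasible_def intro: finite_subset)
    then have "sum p T = sum p (T - {ord i}) + p (ord i)"
      using True by (simp add: sum.remove)
    moreover have "sum p (T - {ord i}) \<le> opt p (Suc i) j"
      using feasible_untake[OF i T(1) True] by (rule opt_ge)
    ultimately show ?thesis using T(2) by simp
  next
    case False
    then have "sum p T \<le> opt p s (Suc j)"
      using T(1) feasible_skip[OF i s] by (intro opt_ge) auto
    then show ?thesis using T(2) by simp
  qed
next
  obtain T where T: "T \<in> feasible (Suc i) j" "sum p T = opt p (Suc i) j"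
    by (rule opt_attained)
  have "opt p (Suc i) j + p (ord i) = sum p (insert (ord i) T)"
    using feasible_take[OF i T(1)] T(2) by simp
  also have "\<dots> \<le> opt p i (Suc j)"
    using feasible_take[OF i T(1)] by (intro opt_ge)
  finally have take: "opt p (Suc i) j + p (ord i) \<le> opt p i (Suc j)" .
  obtain T where T: "T \<in> feasible s (Suc j)" "sum p T = opt p s (Suc j)"
    by (rule opt_attained)
  have "opt p s (Suc j) \<le> opt p i (Suc j)"
    using T feasible_skip[OF i s] opt_ge[of T i "Suc j" p] by auto
  with take show "max (opt p (Suc i) j + p (ord i)) (opt p s (Suc j)) \<le> opt p i (Suc j)"
    by simp
qed

end

section \<open>Weakest preconditions with a time counter\<close>

text \<open>The postcondition also receives the elapsed time, so halting, absence of failure, result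
  and running time are established together.\<close>

definition wp :: "nat \<Rightarrow> prog \<Rightarrow> (state \<Rightarrow> nat \<Rightarrow> bool) \<Rightarrow> state \<Rightarrow> nat \<Rightarrow> bool" where
  "wp M c Q s t \<longleftrightarrow> (\<exists>u s'. runs M c s u s' \<and> Q s' (t + u))"

lemma wp_mono: "wp M c Q s t \<Longrightarrow> (\<And>s t. Q s t \<Longrightarrow> Q' s t) \<Longrightarrow> wp M c Q' s t"
  by (auto simp: wp_def)

lemma wp_Instr:
  "wp M (Instr i) Q s t \<longleftrightarrow> (\<exists>s'. exec M i s = Some s' \<and> Q s' (Suc t))"
  by (auto simp: wp_def intro: runs.Instr elim!: runs.cases[of _ "Instr i"])
     (use runs.Instr in fastforce)

lemma wp_Seq: "wp M (Seq c d) Q s t \<longleftrightarrow> wp M c (wp M d Q) s t"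
proof
  assume "wp M (Seq c d) Q s t"
  then obtain u s' where "runs M (Seq c d) s u s'" "Q s' (t + u)" by (auto simp: wp_def)
  then show "wp M c (wp M d Q) s t"
    by (auto simp: wp_def add.assoc elim!: runs.cases[of _ "Seq c d"])
next
  assume "wp M c (wp M d Q) s t"
  then show "wp M (Seq c d) Q s t"
    unfolding wp_def by (metis add.assoc runs.Seq)
qed

lemma wp_If:
  "wp M (If b c d) Q s t \<longleftrightarrow> (if test_val b s then wp M c Q s (Suc t) else wp M d Q s (Suc t))"
proof -
  have "runs M (If b c d) s u s' \<longleftrightarrow>
    (\<exists>w. u = 1 + w \<and> (if test_val b s then runs M c s w s' else runs M d s w s'))" for u s'
    using runs.IfTrue[of b s M c "u - 1" s' d] runs.IfFalse[of b s M d "u - 1" s' c]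
    by (cases "test_val b s") (auto elim: runs.cases)
  then show ?thesis unfolding wp_def
    by (cases "test_val b s") (simp_all, (metis add_Suc_right)+)
qed

section \<open>Loop rules\<close>

lemma wp_While_False: "\<not> test_val b s \<Longrightarrow> Q s (Suc t) \<Longrightarrow> wp M (While b c) Q s t"
  unfolding wp_def using runs.WhileFalse by (intro exI[of _ 1] exI[of _ s]) simp

lemma wp_While_True:
  assumes "test_val b s" "wp M c (wp M (While b c) Q) s (Suc t)"
  shows "wp M (While b c) Q s t"
proof -
  obtain u s' w s'' where "runs M c s u s'" "runs M (While b c) s' w s''" "Q s'' (Suc t + u + w)"
    using assms(2) by (auto simp: wp_def)
  then show ?thesis
    unfolding wp_def using runs.WhileTrue[OF assms(1)]
    by (intro exI[of _ "1 + u + w"] exI[of _ s'']) (auto simp: add.assoc)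
qed

text \<open>The index must grow strictly but may jump, as a walk that skips whole subtrees requires;
  the bound \<open>N\<close> yields termination.\<close>

lemma wp_While:
  fixes N :: nat
  assumes "I i s t"
    and step: "\<And>i s t. I i s t \<Longrightarrow> test_val b s \<Longrightarrow>
      i < N \<and> wp M c (\<lambda>s t. \<exists>i'>i. I i' s t) s (Suc t)"
    and stop: "\<And>i s t. I i s t \<Longrightarrow> \<not> test_val b s \<Longrightarrow> Q s (Suc t)"
  shows "wp M (While b c) Q s t"
  using assms(1)
proof (induction "N - i" arbitrary: i s t rule: less_induct)
  case less
  show ?case
  proof (cases "test_val b s")
    case True
    show ?thesis
    proof (rule wp_While_True[OF True])
      have "i < N" "wp M c (\<lambda>s t. \<exists>i'>i. I i' s t) s (Suc t)"
        using step[OF less.prems True] by auto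
      then show "wp M c (wp M (While b c) Q) s (Suc t)"
        by (elim wp_mono) (use less.hyps in force)
    qed
  qed (use wp_While_False stop less.prems in blast)
qed

lemma wp_While_upto:
  assumes "I 0 s t"
    and "\<And>i s t. i < N \<Longrightarrow> I i s t \<Longrightarrow> test_val b s"
    and "\<And>i s t. i < N \<Longrightarrow> I i s t \<Longrightarrow> wp M c (I (Suc i)) s (Suc t)"
    and "\<And>s t. I N s t \<Longrightarrow> \<not> test_val b s"
    and "\<And>s t. I N s t \<Longrightarrow> Q s (Suc t)"
  shows "wp M (While b c) Q s t"
proof (rule wp_While[where I = "\<lambda>i s t. i \<le> N \<and> I i s t" and i = 0 and N = N])
  fix i s t
  assume I: "i \<le> N \<and> I i s t" and b: "test_val b s"
  then have "i < N" using assms(4) le_neq_implies_less by blast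
  then show "i < N \<and> wp M c (\<lambda>s t. \<exists>i'>i. i' \<le> N \<and> I i' s t) s (Suc t)"
    using assms(3) I by (fastforce elim: wp_mono)
next
  fix i s t
  assume "i \<le> N \<and> I i s t" "\<not> test_val b s"
  then show "Q s (Suc t)" using assms(2,5) le_neq_implies_less by blast
qed (use assms(1) in auto)

section \<open>The program\<close>

abbreviation Then :: "prog \<Rightarrow> prog \<Rightarrow> prog" (infixr ";;" 60) where
  "c ;; d \<equiv> Seq c d"

abbreviation (input) rN :: reg where "rN \<equiv> 0"
abbreviation (input) rK :: reg where "rK \<equiv> 1"
abbreviation (input) rPar :: reg where "rPar \<equiv> 2"
abbreviation (input) rOne :: reg where "rOne \<equiv> 3"
abbreviation (input) rHead :: reg where "rHead \<equiv> 4"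
abbreviation (input) rSib :: reg where "rSib \<equiv> 5"
abbreviation (input) rBack :: reg where "rBack \<equiv> 6"
abbreviation (input) rWidth :: reg where "rWidth \<equiv> 7"
abbreviation (input) rAddr :: reg where "rAddr \<equiv> 8"
abbreviation (input) rV :: reg where "rV \<equiv> 9"
abbreviation (input) rU :: reg where "rU \<equiv> 10"
abbreviation (input) rW :: reg where "rW \<equiv> 11"
abbreviation (input) rA :: reg where "rA \<equiv> 12"
abbreviation (input) rB :: reg where "rB \<equiv> 13"
abbreviation (input) rC :: reg where "rC \<equiv> 14"
abbreviation (input) rJ :: reg where "rJ \<equiv> 15"

definition get :: "reg \<Rightarrow> reg \<Rightarrow> reg \<Rightarrow> prog" where
  "get d b i = Instr (IOp IAdd rAddr b i) ;; Instr (ILoad d rAddr)"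

definition put :: "reg \<Rightarrow> reg \<Rightarrow> reg \<Rightarrow> prog" where
  "put b i a = Instr (IOp IAdd rAddr b i) ;; Instr (IStore rAddr a)"

text \<open>\<open>rHead\<close> holds \<open>n + 1\<close>, which is also the offset of the table
  in real memory.\<close>

definition row_start :: "reg \<Rightarrow> reg \<Rightarrow> prog" where
  "row_start d v = Instr (IOp IMul d v rWidth) ;; Instr (IOp IAdd d d rHead)"

text \<open>\<open>rPar\<close> keeps its initial 0, the base of the parent array; the other bases
  are multiples of \<open>n + 1\<close>.\<close>

definition init_regs :: prog where
  "init_regs =
     Instr (IConst rOne 1) ;;
     Instr (IOp IAdd rHead rN rOne) ;;
     Instr (IOp IAdd rSib rHead rHead) ;;
     Instr (IOp IAdd rBack rSib rHead) ;;
     Instr (IOp IAdd rWidth rK rOne)"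

text \<open>\<open>n\<close> marks an empty list. The dummy root has a list too, and its sibling
  cell receives its \<open>skip\<close> value \<open>n\<close>.\<close>

definition clear_heads :: prog where
  "clear_heads =
     Instr (IConst rV 0) ;;
     While (ILess rV rN) (
       put rHead rV rN ;;
       Instr (IOp IAdd rV rV rOne)) ;;
     put rHead rN rN ;;
     put rSib rN rN"

text \<open>Nodes are prepended in increasing order, so lists are decreasing and the old head found
  for \<open>v\<close> is \<open>last_child v (parent v)\<close>.\<close>

definition build_lists :: prog where
  "build_lists =
     Instr (IConst rV 0) ;;
     While (ILess rV rN) (
       get rU rPar rV ;;
       get rW rHead rU ;;
       put rSib rV rW ;;
       put rHead rU rV ;;
       Instr (IOp IAdd rV rV rOne))"

text \<open>
  Turns the sibling array into \<open>skip\<close> and the head array into \<open>first\<close>.  Preorder visits the parent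
  before \<open>v\<close>, so the sibling cell of the parent already holds its \<open>skip\<close> value.
\<close>

definition thread_step :: prog where
  "thread_step =
     get rU rSib rV ;;
     If (IEq rU rN) (get rU rPar rV ;; get rU rSib rU) (Instr (IMove rU rU)) ;;
     put rSib rV rU ;;
     get rW rHead rV ;;
     If (IEq rW rN) (Instr (IMove rW rU)) (Instr (IMove rW rW)) ;;
     put rHead rV rW ;;
     put rBack rW rV ;;
     Instr (IMove rV rW)"

definition thread :: prog where
  "thread =
     get rV rHead rN ;;
     put rBack rV rN ;;
     While (ILess rV rN) thread_step"

text \<open>\<open>rB\<close> is read before it advances and \<open>rC\<close> afterwards: taking
  the node refers to column \<open>j\<close>, refusing it to column \<open>j + 1\<close>. Column 0
  keeps its initial zeros.\<close>

definition fill_cell :: prog where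
  "fill_cell =
     Instr (RLoad 1 rB) ;;
     Instr (ROp RAdd 1 1 0) ;;
     Instr (IOp IAdd rA rA rOne) ;;
     Instr (IOp IAdd rB rB rOne) ;;
     Instr (IOp IAdd rC rC rOne) ;;
     Instr (RLoad 2 rC) ;;
     If (RLess 2 1) (Instr (RStore rA 1)) (Instr (RStore rA 2)) ;;
     Instr (IOp IAdd rJ rJ rOne)"

definition fill_row :: prog where
  "fill_row = Instr (IConst rJ 0) ;; While (ILess rJ rK) fill_cell"

definition fill_table_step :: prog where
  "fill_table_step =
     get rW rSib rV ;;
     row_start rA rV ;;
     row_start rB rU ;;
     row_start rC rW ;;
     Instr (RLoad 0 rV) ;;
     fill_row ;;
     Instr (IMove rU rV) ;;
     get rV rBack rU"

text \<open>Walks the preorder backwards from the dummy root, with \<open>rU\<close> one position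
  after \<open>rV\<close>. The row of \<open>n\<close> is never written; its zeros are the base case
  \<open>opt_end\<close>.\<close>

definition fill_table :: prog where
  "fill_table =
     Instr (IMove rU rN) ;;
     get rV rBack rU ;;
     While (ILess rV rN) fill_table_step"

text \<open>The output takes the place of the parent array, which is last read by
  \<open>thread_step\<close>.\<close>

definition clear_output :: prog where
  "clear_output =
     Instr (IConst rV 0) ;;
     Instr (IConst rW 0) ;;
     While (ILess rV rN) (
       put rPar rV rW ;;
       Instr (IOp IAdd rV rV rOne))"

text \<open>
  Comparing the entries of \<open>v\<close> and of the node after its subtree decides whether to take \<open>v\<close>; when
  the budget is exhausted both entries are \<open>0\<close>, so nothing is taken.
\<close>

definition trace_step :: prog where
  "trace_step =
     get rW rSib rV ;;
     row_start rA rV ;;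
     Instr (IOp IAdd rA rA rJ) ;;
     row_start rC rW ;;
     Instr (IOp IAdd rC rC rJ) ;;
     Instr (RLoad 1 rA) ;;
     Instr (RLoad 2 rC) ;;
     If (RLess 2 1)
       (put rPar rV rOne ;;
        Instr (IOp ISub rJ rJ rOne) ;;
        get rV rHead rV)
       (Instr (IMove rV rW))"

definition trace_back :: prog where
  "trace_back =
     Instr (IMove rJ rK) ;;
     get rV rHead rN ;;
     While (ILess rV rN) trace_step"

definition knapsack :: prog where
  "knapsack = init_regs ;; clear_heads ;; build_lists ;; thread ;; fill_table ;; clear_output ;; trace_back"

section \<open>Correctness and running time\<close>

text \<open>The bounds on \<open>M\<close> come from four integer arrays of length
  \<open>n + 1\<close>, and from \<open>n + 1\<close> real cells in front of \<open>n + 1\<close>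
  rows of \<open>k + 1\<close> entries.\<close>

locale tree_knapsack = chunk_forest +
  fixes p :: "nat \<Rightarrow> real" and k M :: nat
  assumes cells: "4 * (n + 1) \<le> M" "(n + 1) * (k + 2) < M"
begin

text \<open>
  Integer memory holds four arrays of length \<open>n + 1\<close>: parents (later the output), heads of child
  lists, siblings, and backward links.  Real memory holds the profits, followed by the table with
  one row of length \<open>k + 1\<close> per node.
\<close>

definition adr :: "nat \<Rightarrow> nat \<Rightarrow> nat" where
  "adr b v = b * Suc n + v"

definition width :: nat where
  "width = Suc k"

definition row :: "nat \<Rightarrow> nat \<Rightarrow> nat" where
  "row v j = Suc n + v * width + j"

section \<open>Address arithmetic\<close>

lemma adr_add [simp]: "adr b 0 + v = adr b v"
  by (simp add: adr_def)

text \<open>Block and offset are quotient and remainder modulo \<open>Suc n\<close>; as a simp rule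
  this settles all aliasing among the integer arrays.\<close>

lemma adr_eq_iff [simp]: "u \<le> n \<Longrightarrow> v \<le> n \<Longrightarrow> adr b u = adr c v \<longleftrightarrow> b = c \<and> u = v"
proof -
  have "(b * Suc n + u) div Suc n = b" "(b * Suc n + u) mod Suc n = u" if "u \<le> n" for b u
    using that div_mult_self3[of "Suc n" b u] mod_mult_self3[of b "Suc n" u]
    by (auto simp del: mult_Suc_right)
  then show "u \<le> n \<Longrightarrow> v \<le> n \<Longrightarrow> ?thesis" unfolding adr_def by metis
qed

lemma adr_less [simp]: "b < 4 \<Longrightarrow> v \<le> n \<Longrightarrow> adr b v < M"
proof -
  assume "b < 4" "v \<le> n"
  then have "Suc b * Suc n \<le> 4 * Suc n" by (intro mult_le_mono1) simp
  with \<open>v \<le> n\<close> cells(1) show ?thesis by (simp add: adr_def)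
qed

lemma row_base [simp]: "v * width + adr (Suc 0) 0 = row v 0"
  by (simp add: row_def adr_def)

lemma row_add [simp]: "row v 0 + j = row v j"
  by (simp add: row_def)

lemma row_Suc [simp]: "Suc (row v j) = row v (Suc j)"
  by (simp add: row_def)

lemma row_eq_iff [simp]: "i \<le> k \<Longrightarrow> j \<le> k \<Longrightarrow> row u i = row v j \<longleftrightarrow> u = v \<and> i = j"
proof -
  have "(u * Suc k + i) div Suc k = u" "(u * Suc k + i) mod Suc k = i" if "i \<le> k" for u i
    using that div_mult_self3[of "Suc k" u i] mod_mult_self3[of u "Suc k" i]
    by (auto simp del: mult_Suc_right)
  then show "i \<le> k \<Longrightarrow> j \<le> k \<Longrightarrow> ?thesis"
    unfolding row_def width_def by (metis add.assoc add_left_cancel)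
qed

lemma row_less [simp]: "v \<le> n \<Longrightarrow> j \<le> k \<Longrightarrow> row v j < M"
proof -
  assume a: "v \<le> n" "j \<le> k"
  have "row v j \<le> Suc n + n * Suc k + k"
    unfolding row_def width_def using a by (intro add_mono mult_le_mono1) auto
  also have "\<dots> < M" using cells(2) by (simp add: algebra_simps)
  finally show ?thesis .
qed

lemma mult_width_less [simp]: "v \<le> n \<Longrightarrow> v * width < M"
  using row_less[of v 0] by (simp add: row_def)

lemma row_neq [simp]: "u \<le> n \<Longrightarrow> row v j \<noteq> u" "u \<le> n \<Longrightarrow> u \<noteq> row v j"
  by (auto simp: row_def)

lemma small_less [simp]: "v \<le> Suc n \<Longrightarrow> v < M" "j \<le> Suc k \<Longrightarrow> j < M" "0 < M" "Suc 0 < M"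
proof -
  show "v \<le> Suc n \<Longrightarrow> v < M" "0 < M" "Suc 0 < M" using cells(1) by auto
  have "1 * (k + 2) \<le> (n + 1) * (k + 2)" by (rule mult_le_mono1) simp
  then show "j \<le> Suc k \<Longrightarrow> j < M" using cells(2) by simp
qed

text \<open>Registers up to 7 are constant after initialisation; scratch registers have larger
  numbers, so \<open>regs_ok_upd\<close> can discard their updates.\<close>

definition regs_ok :: "state \<Rightarrow> bool" where
  "regs_ok s \<longleftrightarrow> ireg s rN = n \<and> ireg s rK = k \<and> ireg s rPar = adr 0 0 \<and> ireg s rOne = 1 \<and>
     ireg s rHead = adr 1 0 \<and> ireg s rSib = adr 2 0 \<and> ireg s rBack = adr 3 0 \<and>
     ireg s rWidth = width"

lemmas run = wp_Seq wp_Instr wp_If get_def put_def row_start_def Let_def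

lemma wp_init_regs:
  assumes "ireg s rN = n" "ireg s rK = k" "ireg s rPar = 0"
  shows "wp M init_regs (\<lambda>s' u. regs_ok s' \<and> imem s' = imem s \<and> rmem s' = rmem s \<and> u \<le> t + 5) s t"
proof -
  have "Suc (Suc (n + n)) < M" "Suc (Suc (Suc (n + n + n))) < M" using cells(1) by auto
  then show ?thesis
    using assms small_less(1)[of "Suc n"] small_less(2)[of "Suc k"]
    by (simp add: init_regs_def run regs_ok_def adr_def width_def)
qed

lemma regs_okD [simp]:
  assumes "regs_ok s"
  shows "ireg s rN = n" "ireg s rK = k" "ireg s (Suc 0) = k" "ireg s rPar = adr 0 0" "ireg s rOne = 1"
    "ireg s rHead = adr (Suc 0) 0" "ireg s rSib = adr 2 0" "ireg s rBack = adr 3 0"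
    "ireg s rWidth = width"
  using assms by (simp_all only: regs_ok_def One_nat_def)

lemma regs_ok_upd [simp]:
  "7 < d \<Longrightarrow> regs_ok (s\<lparr>ireg := f(d := x)\<rparr>) = regs_ok (s\<lparr>ireg := f\<rparr>)"
  "regs_ok (s\<lparr>ireg := ireg s\<rparr>) = regs_ok s"
  "regs_ok (s\<lparr>rreg := g\<rparr>) = regs_ok s"
  "regs_ok (s\<lparr>imem := m\<rparr>) = regs_ok s"
  "regs_ok (s\<lparr>rmem := h\<rparr>) = regs_ok s"
  by (simp_all add: regs_ok_def del: regs_okD)

section \<open>Building the child lists\<close>

lemma wp_clear_heads:
  assumes "regs_ok s"
  shows "wp M clear_heads (\<lambda>s' u. regs_ok s' \<and> rmem s' = rmem s \<and>
    (\<forall>v\<le>n. imem s' (adr 0 v) = imem s (adr 0 v)) \<and> (\<forall>v\<le>n. imem s' (adr 1 v) = n) \<and>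
    imem s' (adr 2 n) = n \<and> u \<le> t + 6 + 4 * n) s t"
proof -
  let ?I = "\<lambda>i s' u. regs_ok s' \<and> rmem s' = rmem s \<and> ireg s' rV = i \<and>
    (\<forall>v\<le>n. imem s' (adr 0 v) = imem s (adr 0 v)) \<and> (\<forall>v<i. imem s' (adr 1 v) = n) \<and>
    u \<le> t + 1 + 4 * i"
  show ?thesis
    unfolding clear_heads_def wp_Seq
    apply (simp add: run)
    apply (rule wp_While_upto[where I = ?I and N = n])
        apply (simp add: assms)
       apply simp
      apply (simp add: run All_less_Suc)
     apply simp
    apply (simp add: run)
    done
qed

lemma wp_build_lists:
  assumes "regs_ok s" "\<forall>v<n. imem s (adr 0 v) = parent v" "\<forall>v\<le>n. imem s (adr 1 v) = n"
    "imem s (adr 2 n) = n"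
  shows "wp M build_lists (\<lambda>s' u. regs_ok s' \<and> rmem s' = rmem s \<and>
    (\<forall>v<n. imem s' (adr 0 v) = parent v) \<and> (\<forall>v\<le>n. imem s' (adr 1 v) = last_child n v) \<and>
    (\<forall>v<n. imem s' (adr 2 v) = last_child v (parent v)) \<and>
    imem s' (adr 2 n) = n \<and> u \<le> t + 2 + 10 * n) s t"
proof -
  \<comment> \<open>After \<open>i\<close> insertions the heads are given by
    \<open>last_child i\<close> and the sibling cells below \<open>i\<close> are final. An iteration
    costs 10, test included.\<close>
  let ?I = "\<lambda>i s' u. regs_ok s' \<and> rmem s' = rmem s \<and> ireg s' rV = i \<and>
    (\<forall>v<n. imem s' (adr 0 v) = parent v) \<and> (\<forall>v\<le>n. imem s' (adr 1 v) = last_child i v) \<and>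
    (\<forall>v<i. imem s' (adr 2 v) = last_child v (parent v)) \<and>
    imem s' (adr 2 n) = n \<and> u \<le> t + 1 + 10 * i"
  show ?thesis
    unfolding build_lists_def wp_Seq
    apply (simp add: run)
    apply (rule wp_While_upto[where I = ?I and N = n])
    using assms
        apply (simp)
       apply simp
      apply (simp add: run All_less_Suc parent_le)
     apply simp
    apply (simp add: run)
    done
qed


section \<open>Threading the lists into preorder\<close>

definition threaded :: "state \<Rightarrow> bool" where
  "threaded s \<longleftrightarrow> (\<forall>q\<le>n. imem s (adr 1 (ord q)) = ord (Suc q) \<and>
     imem s (adr 2 (ord q)) = skip (ord q) \<and> imem s (adr 3 (ord (Suc q))) = ord q)"

lemma wp_thread_step:
  assumes "regs_ok s" "ireg s rV = v" "v < n"
    "imem s (adr 0 v) = parent v" "imem s (adr 1 v) = last_child n v"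
    "imem s (adr 2 v) = last_child v (parent v)"
    "imem s (adr 2 (parent v)) = skip (parent v)"
  shows "wp M thread_step
     (\<lambda>s' u. regs_ok s' \<and> rmem s' = rmem s \<and> ireg s' rV = first v \<and>
       imem s' = (imem s)(adr 2 v := skip v, adr 1 v := first v, adr 3 (first v) := v) \<and>
       u \<le> t + 18) s t"
proof -
  have "skip v \<le> n" "first v \<le> n" "parent v \<le> n" "last_child n v \<le> n"
    "last_child v (parent v) \<le> n"
    using assms(3) skip_le first_le parent_le last_child_le by auto
  then show ?thesis
    using assms skip_eq[of v] first_def[of v]
    by (cases "last_child v (parent v) = n"; cases "last_child n v = n")
      (simp_all add: thread_step_def run)
qed

text \<open>Positions up to \<open>i\<close> are threaded while later ones still hold lists. By
  \<open>ord_parent\<close> the parent of the current node is already threaded, as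
  \<open>wp_thread_step\<close> requires.\<close>

lemma wp_thread:
  assumes "regs_ok s" "\<forall>v<n. imem s (adr 0 v) = parent v"
    "\<forall>v\<le>n. imem s (adr 1 v) = last_child n v"
    "\<forall>v<n. imem s (adr 2 v) = last_child v (parent v)" "imem s (adr 2 n) = n"
  shows "wp M thread (\<lambda>s' u. regs_ok s' \<and> rmem s' = rmem s \<and> threaded s' \<and>
    u \<le> t + 5 + 20 * n) s t"
proof -
  define I where "I = (\<lambda>i s' u. regs_ok s' \<and> rmem s' = rmem s \<and> ireg s' rV = ord (Suc i) \<and>
    (\<forall>v<n. imem s' (adr 0 v) = parent v) \<and>
    (\<forall>q\<le>i. imem s' (adr 1 (ord q)) = ord (Suc q) \<and> imem s' (adr 2 (ord q)) = skip (ord q) \<and>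
       imem s' (adr 3 (ord (Suc q))) = ord q) \<and>
    (\<forall>q\<le>n. i < q \<longrightarrow> imem s' (adr 1 (ord q)) = last_child n (ord q) \<and>
       imem s' (adr 2 (ord q)) = last_child (ord q) (parent (ord q))) \<and>
    u \<le> t + 4 + 20 * i)"
  have o1: "ord (Suc 0) = last_child n n" by (simp add: ord_Suc ord_0 first_root)
  have h: "imem s (adr (Suc 0) n) = ord (Suc 0)" using assms(3) o1 by simp
  have o1_le: "ord (Suc 0) \<le> n" using ord_le by simp
  \<comment> \<open>Position 0 is complete at the start: the head of \<open>n\<close> is
    \<open>first n\<close>, its sibling cell holds \<open>skip n = n\<close>, and the first back
    link has just been written.\<close>
  have init: "I 0 s' (Suc (Suc (Suc (Suc t))))" if "regs_ok s'" "rmem s' = rmem s" "ireg s' rV = ord (Suc 0)"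
      "imem s' = (imem s)(adr 3 (ord (Suc 0)) := n)" for s'
    unfolding I_def
  proof (intro conjI allI impI)
    fix q assume q: "q \<le> n" "0 < q"
    then have "ord q < n" by (intro ord_less)
    then show "imem s' (adr 1 (ord q)) = last_child n (ord q)"
      "imem s' (adr 2 (ord q)) = last_child (ord q) (parent (ord q))"
      using that assms o1_le by simp_all
  qed (use that assms o1 o1_le in \<open>simp_all add: ord_0 skip_root\<close>)
  have step: "wp M thread_step (I (Suc i)) s' (Suc u)" if i: "i < n" and I: "I i s' u" for i s' u
  proof -
    define v where "v = ord (Suc i)"
    have v: "v < n" using i ord_less[of "Suc i"] by (simp add: v_def)
    obtain q where q: "q < Suc i" "parent v = ord q"
      using ord_parent[of "Suc i"] i unfolding v_def by (metis Suc_leI zero_less_Suc)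
    have fv: "first v = ord (Suc (Suc i))" by (simp add: v_def ord_Suc)
    show ?thesis
    proof (rule wp_mono[OF wp_thread_step[where v = v]])
      fix s'' u'
      assume a: "regs_ok s'' \<and> rmem s'' = rmem s' \<and> ireg s'' rV = first v \<and>
       imem s'' = (imem s')(adr 2 v := skip v, adr 1 v := first v, adr 3 (first v) := v) \<and>
       u' \<le> Suc u + 18"
      have m: "imem s'' = (imem s')(adr 2 v := skip v, adr 1 v := first v, adr 3 (first v) := v)"
        using a by blast
      have fl: "first v \<le> n" using v first_le by simp
      have m0: "imem s'' (adr 0 x) = imem s' (adr 0 x)" if "x \<le> n" for x
        unfolding m using that v fl by simp
      \<comment> \<open>Successor and skip cells are indexed by positions 0 to \<open>n\<close>,
        back links by 1 to \<open>Suc n\<close>; hence two different injectivity facts.\<close>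
      have m1: "imem s'' (adr 1 (ord r)) = (if r = Suc i then first v else imem s' (adr 1 (ord r)))"
        if "r \<le> n" for r
        unfolding m using that v fl ord_le[of r] ord_eq_iff_atMost[of r "Suc i"] i
        by (simp add: v_def)
      have m2: "imem s'' (adr 2 (ord r)) = (if r = Suc i then skip v else imem s' (adr 2 (ord r)))"
        if "r \<le> n" for r
        unfolding m using that v fl ord_le[of r] ord_eq_iff_atMost[of r "Suc i"] i
        by (simp add: v_def)
      have m3: "imem s'' (adr 3 (ord (Suc r))) = (if r = Suc i then v else imem s' (adr 3 (ord (Suc r))))"
        if "r \<le> n" for r
        unfolding m using that v fl ord_le[of "Suc r"] ord_eq_iff[of "Suc r" "Suc (Suc i)"] i
        by (simp add: fv)
      have I': "imem s' (adr 1 (ord r)) = ord (Suc r)" "imem s' (adr 2 (ord r)) = skip (ord r)"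
         "imem s' (adr 3 (ord (Suc r))) = ord r" if "r \<le> i" for r
        using I that unfolding I_def by auto
      show "I (Suc i) s'' u'"
        unfolding I_def
      proof (intro conjI allI impI)
        fix r assume "r \<le> Suc i"
        then have r: "r \<le> n" "r \<noteq> Suc i \<Longrightarrow> r \<le> i" using i by auto
        show "imem s'' (adr 1 (ord r)) = ord (Suc r)"
          using m1[OF r(1)] r(2) I'(1)[of r] fv by (cases "r = Suc i") auto
        show "imem s'' (adr 2 (ord r)) = skip (ord r)"
          using m2[OF r(1)] r(2) I'(2)[of r] v_def by (cases "r = Suc i") auto
        show "imem s'' (adr 3 (ord (Suc r))) = ord r"
          using m3[OF r(1)] r(2) I'(3)[of r] v_def by (cases "r = Suc i") auto
      next
        fix r assume r: "r \<le> n" "Suc i < r"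
        then show "imem s'' (adr 1 (ord r)) = last_child n (ord r)"
          "imem s'' (adr 2 (ord r)) = last_child (ord r) (parent (ord r))"
          using m1[OF r(1)] m2[OF r(1)] I unfolding I_def by auto
      qed (use a I m0 fv in \<open>simp_all add: I_def\<close>)
    qed (use I v i q in \<open>simp_all add: I_def v_def less_Suc_eq_le\<close>)
  qed
  show ?thesis
    unfolding thread_def
    apply (simp add: run assms(1) h o1_le)
    apply (rule wp_While_upto[where I = I and N = n])
        apply (rule init; simp add: assms(1))
       apply (simp add: I_def ord_less)
      apply (rule step, assumption+)
     apply (simp add: I_def ord_end)
    apply (simp add: I_def threaded_def)
    done
qed

section \<open>Filling the table\<close>

lemma wp_fill_row:
  assumes "regs_ok s" "v \<le> n" "w \<le> n" "x \<le> n" "v \<noteq> w" "v \<noteq> x"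
    and ptrs: "ireg s rA = row v 0" "ireg s rB = row w 0" "ireg s rC = row x 0"
    and vals: "\<forall>j\<le>k. rmem s (row w j) = f j" "\<forall>j\<le>k. rmem s (row x j) = g j"
      "rmem s (row v 0) = h 0" "\<forall>j<k. h (Suc j) = max (f j + rreg s 0) (g (Suc j))"
  shows "wp M fill_row (\<lambda>s' u. regs_ok s' \<and> imem s' = imem s \<and> ireg s' rV = ireg s rV \<and>
    (\<forall>j\<le>k. rmem s' (row v j) = h j) \<and>
    (\<forall>a. (\<forall>j\<le>k. a \<noteq> row v j) \<longrightarrow> rmem s' a = rmem s a) \<and> u \<le> t + 2 + 10 * k) s t"
proof -
  \<comment> \<open>Only the target row changes, so the source rows keep their values; these two may
    coincide, as they do at a leaf. A cell costs 10, test included.\<close>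
  define I where "I = (\<lambda>i s' u. regs_ok s' \<and> imem s' = imem s \<and> ireg s' rV = ireg s rV \<and>
    rreg s' 0 = rreg s 0 \<and> ireg s' rJ = i \<and>
    ireg s' rA = row v i \<and> ireg s' rB = row w i \<and> ireg s' rC = row x i \<and>
    (\<forall>j\<le>i. rmem s' (row v j) = h j) \<and>
    (\<forall>a. (\<forall>j\<le>k. a \<noteq> row v j) \<longrightarrow> rmem s' a = rmem s a) \<and> u \<le> t + 1 + 10 * i)"
  have step: "wp M fill_cell (I (Suc i)) s' (Suc u)" if i: "i < k" and I: "I i s' u" for i s' u
  proof -
    have fr: "rmem s' (row y j) = rmem s (row y j)" if "y \<noteq> v" "j \<le> k" for y j
      using I that unfolding I_def by simp
    have vw: "rmem s' (row w i) = f i" "rmem s' (row x (Suc i)) = g (Suc i)"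
      using fr[of w i] fr[of x "Suc i"] assms i by auto
    have hi: "h (Suc i) = max (f i + rreg s 0) (g (Suc i))" using vals(4) i by blast
    have hv: "rmem s' (row v j) = h j" if "j \<le> i" for j using I that unfolding I_def by simp
    have ho: "rmem s' a = rmem s a" if "\<forall>j\<le>k. a \<noteq> row v j" for a using I that unfolding I_def by blast
    have regs: "regs_ok s'" "imem s' = imem s" "ireg s' rV = ireg s rV"
      "rreg s' 0 = rreg s 0" "ireg s' rJ = i"
      "ireg s' rA = row v i" "ireg s' rB = row w i" "ireg s' rC = row x i" "u \<le> t + 1 + 10 * i"
      using I unfolding I_def by simp_all
    have "I (Suc i) s'' u''" if "regs_ok s''" "imem s'' = imem s" "ireg s'' rV = ireg s rV"
      "rreg s'' 0 = rreg s 0" "ireg s'' rJ = Suc i"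
      "ireg s'' rA = row v (Suc i)" "ireg s'' rB = row w (Suc i)" "ireg s'' rC = row x (Suc i)"
      "u'' \<le> t + 11 + 10 * i" "rmem s'' = (rmem s')(row v (Suc i) := h (Suc i))" for s'' u''
      unfolding I_def using that i by (auto simp: hv ho le_Suc_eq)
    then show ?thesis
      using regs vw i hi assms(2-4) by (simp add: run fill_cell_def)
  qed
  show ?thesis
    unfolding fill_row_def
    apply (simp add: run)
    apply (rule wp_While_upto[where I = I and N = k])
        apply (simp add: I_def assms)
       apply (simp add: I_def)
      apply (rule step, assumption+)
     apply (simp add: I_def)
    apply (simp add: I_def)
    done
qed


lemma wp_fill_table:
  assumes "regs_ok s" "threaded s" "\<forall>v<n. rmem s v = p v"
    and zero: "\<forall>v\<le>n. \<forall>j\<le>k. rmem s (row v j) = 0"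
  shows "wp M fill_table (\<lambda>s' u. regs_ok s' \<and> imem s' = imem s \<and>
    (\<forall>q j. 0 < q \<and> q \<le> Suc n \<and> j \<le> k \<longrightarrow> rmem s' (row (ord q) j) = opt p q j) \<and>
    u \<le> t + 4 + n * (15 + 10 * k)) s t"
proof -
  \<comment> \<open>Cost of one row: 10 per cell, and 15 for links, row addresses, the profit and
    the loop tests.\<close>
  define D where "D = 15 + 10 * k"
  \<comment> \<open>After \<open>i\<close> rounds the rows from position \<open>Suc n - i\<close> on
    are final; at \<open>i = n\<close> the current node is \<open>ord 0 = n\<close> and the loop
    stops.\<close>
  define I where "I = (\<lambda>i s' u. regs_ok s' \<and> imem s' = imem s \<and>
    ireg s' rU = ord (Suc n - i) \<and> ireg s' rV = ord (n - i) \<and> (\<forall>v<n. rmem s' v = p v) \<and>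
    (\<forall>v\<le>n. rmem s' (row v 0) = 0) \<and>
    (\<forall>q j. Suc n - i \<le> q \<and> q \<le> Suc n \<and> j \<le> k \<longrightarrow> rmem s' (row (ord q) j) = opt p q j) \<and>
    u \<le> t + 3 + i * D)"
  have bk: "imem s (adr 3 (ord (Suc q))) = ord q" if "q \<le> n" for q
    using assms(2) that unfolding threaded_def by blast
  have bn: "imem s (adr 3 n) = ord n" using bk[of n] by (simp add: ord_end)
  have step: "wp M fill_table_step (I (Suc i)) s' (Suc u)" if i: "i < n" and I: "I i s' u" for i s' u
  proof -
    define r where "r = n - i"
    define v where "v = ord r"
    define w where "w = ord (Suc r)"
    have r: "0 < r" "r \<le> n" "Suc n - i = Suc r" "n - Suc i = r - 1" "Suc (r - 1) = r"
      using i by (auto simp: r_def)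
    obtain q where q: "r < q" "q \<le> Suc n" "ord q = skip v"
      using ord_skip[OF r(1,2)] unfolding v_def by metis
    have v: "v < n" unfolding v_def using r by (simp add: ord_less)
    have vM: "v < M" using v by simp
    have w: "w \<le> n" unfolding w_def using r by (simp add: ord_le)
    have x: "skip v \<le> n" using v by (simp add: skip_le)
    have vw: "v \<noteq> w" unfolding v_def w_def using r by (simp add: ord_eq_iff)
    have "ord r \<noteq> ord q" using ord_eq_iff[of r q] r(1,2) q(1,2) by simp
    then have vx: "v \<noteq> skip v" using q(3) unfolding v_def by simp
    have sk: "imem s (adr 2 v) = skip v"
      using assms(2) r unfolding threaded_def v_def by blast
    have bv: "imem s (adr 3 v) = ord (r - 1)"
      using bk[of "r - 1"] r unfolding v_def by simp
    have st: "regs_ok s'" "imem s' = imem s" "ireg s' rU = w" "ireg s' rV = v"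
      "rmem s' v = p v" "rmem s' (row v 0) = opt p r 0" "u \<le> t + 3 + i * D"
      using I v r unfolding I_def by (simp_all add: v_def w_def opt_0 r_def[symmetric])
    have tab: "rmem s' (row (ord l) j) = opt p l j" if "r < l" "l \<le> Suc n" "j \<le> k" for l j
      using I that r unfolding I_def by simp
    have tw: "\<forall>j\<le>k. rmem s' (row w j) = opt p (Suc r) j"
      using tab[of "Suc r"] r unfolding w_def by simp
    have tx: "\<forall>j\<le>k. rmem s' (row (skip v) j) = opt p q j"
      using tab[of q] q by simp
    have rec: "\<forall>j<k. opt p r (Suc j) = max (opt p (Suc r) j + p v) (opt p q (Suc j))"
      using opt_Suc[of r q] r q unfolding v_def by simp
    have final: "I (Suc i) s2 u2" if
      "regs_ok s2" "imem s2 = imem s" "ireg s2 rU = v" "ireg s2 rV = ord (r - 1)"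
      "\<forall>j\<le>k. rmem s2 (row v j) = opt p r j"
      "\<forall>a. (\<forall>j\<le>k. a \<noteq> row v j) \<longrightarrow> rmem s2 a = rmem s' a" "u2 \<le> u + D" for s2 u2
      unfolding I_def
    proof (intro conjI allI impI)
      fix l assume "l < n"
      then show "rmem s2 l = p l" using that(6) I unfolding I_def by simp
    next
      fix l assume "l \<le> n"
      then show "rmem s2 (row l 0) = 0"
        using that(5,6) I unfolding I_def by (cases "l = v") (simp_all add: opt_0)
    next
      fix l j assume l: "Suc n - Suc i \<le> l \<and> l \<le> Suc n \<and> j \<le> k"
      show "rmem s2 (row (ord l) j) = opt p l j"
      proof (cases "l = r")
        case True
        then show ?thesis using that(5) l unfolding v_def by simp
      next
        case False
        then have "r < l" using l by (simp add: r_def)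
        moreover from this have "ord l \<noteq> v" unfolding v_def using ord_eq_iff[of l r] r l by simp
        ultimately show ?thesis using that(6) tab l by simp
      qed
    next
      show "u2 \<le> t + 3 + Suc i * D" using that(7) st(7) by simp
    qed (use that r in \<open>simp_all add: v_def r_def[symmetric]\<close>)
    show ?thesis
      unfolding fill_table_step_def
      apply (simp add: run st sk v w x vM less_imp_le)
      apply (rule wp_mono)
       apply (rule wp_fill_row[where v = v and w = w and x = "skip v" and f = "opt p (Suc r)"
             and g = "opt p q" and h = "opt p r"])
      using v w x vw vx st tw tx rec
                   apply (simp_all add: run bv sk less_imp_le)
      apply (rule final)
      apply (simp_all add: D_def)
      done
  qed
  have init: "I 0 s' (Suc (Suc (Suc t)))" if "regs_ok s'" "imem s' = imem s" "rmem s' = rmem s"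
    "ireg s' rU = n" "ireg s' rV = ord n" for s'
    unfolding I_def
  proof (intro conjI allI impI)
    fix q j assume "Suc n - 0 \<le> q \<and> q \<le> Suc n \<and> j \<le> k"
    then have "q = Suc n" "j \<le> k" by simp_all
    then show "rmem s' (row (ord q) j) = opt p q j"
      using zero that by (simp add: ord_end opt_end)
  qed (use that assms in \<open>simp_all add: ord_end\<close>)
  show ?thesis
    unfolding fill_table_def
    apply (simp add: run assms(1) bn)
    apply (rule wp_While_upto[where I = I and N = n])
        apply (rule init; simp add: assms(1))
       apply (simp add: I_def ord_less)
      apply (rule step, assumption+)
     apply (simp add: I_def ord_0)
    apply (simp add: I_def D_def)
    done
qed

section \<open>Reading off an optimal placement\<close>

lemma wp_clear_output:
  assumes "regs_ok s"
  shows "wp M clear_output (\<lambda>s' u. regs_ok s' \<and> rmem s' = rmem s \<and>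
    (\<forall>v<n. imem s' (adr 0 v) = 0) \<and>
    (\<forall>b v. 0 < b \<and> v \<le> n \<longrightarrow> imem s' (adr b v) = imem s (adr b v)) \<and> u \<le> t + 3 + 4 * n) s t"
proof -
  let ?I = "\<lambda>i s' u. regs_ok s' \<and> rmem s' = rmem s \<and> ireg s' rV = i \<and> ireg s' rW = 0 \<and>
    (\<forall>v<i. imem s' (adr 0 v) = 0) \<and>
    (\<forall>b v. 0 < b \<and> v \<le> n \<longrightarrow> imem s' (adr b v) = imem s (adr b v)) \<and> u \<le> t + 2 + 4 * i"
  show ?thesis
    unfolding clear_output_def
    apply (simp add: run)
    apply (rule wp_While_upto[where I = ?I and N = n])
        apply (simp add: assms)
       apply simp
      apply (simp add: run All_less_Suc)
     apply simp
    apply simp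
    done
qed

lemma wp_trace_step:
  assumes "regs_ok s" "ireg s rV = v" "v < n" "ireg s rJ = j" "j \<le> k"
    "imem s (adr 1 v) = w" "imem s (adr 2 v) = x" "x \<le> n"
  shows "wp M trace_step (\<lambda>s' u. regs_ok s' \<and> rmem s' = rmem s \<and> u \<le> t + 16 \<and>
    (if rmem s (row x j) < rmem s (row v j)
     then ireg s' rV = w \<and> ireg s' rJ = j - 1 \<and> imem s' = (imem s)(adr 0 v := 1)
     else ireg s' rV = x \<and> ireg s' rJ = j \<and> imem s' = imem s)) s t"
proof -
  have "j - 1 < M" using assms(5) by simp
  then show ?thesis
    using assms by (simp add: trace_step_def run)
qed

lemma wp_trace_back:
  assumes "regs_ok s" "threaded s" "\<forall>v<n. imem s (adr 0 v) = 0"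
    and tab: "\<forall>q j. 0 < q \<and> q \<le> Suc n \<and> j \<le> k \<longrightarrow> rmem s (row (ord q) j) = opt p q j"
  shows "wp M trace_back (\<lambda>s' u. u \<le> t + 4 + 17 * n \<and>
    (\<exists>S\<in>feasible (Suc 0) k. sum p S = opt p (Suc 0) k \<and>
      (\<forall>v<n. imem s' (adr 0 v) = (if v \<in> S then 1 else 0)))) s t"
proof -
  \<comment> \<open>\<open>S\<close> holds the nodes chosen before position \<open>i\<close>: every
    feasible completion stays feasible, and an optimal one attains the overall optimum. At
    \<open>i = Suc n\<close> only the empty completion remains. Writing \<open>u + 17\<close> avoids
    subtracting 1 from \<open>i\<close>, which starts at 1.\<close>
  define I where "I = (\<lambda>i s' u. 0 < i \<and> i \<le> Suc n \<and> regs_ok s' \<and> rmem s' = rmem s \<and>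
    ireg s' rV = ord i \<and> ireg s' rJ \<le> k \<and> u + 17 \<le> t + 3 + 17 * i \<and>
    (\<forall>v\<le>n. imem s' (adr 1 v) = imem s (adr 1 v) \<and> imem s' (adr 2 v) = imem s (adr 2 v)) \<and>
    (\<exists>S. S \<subseteq> ord ` {0<..<i} \<and> (\<forall>T\<in>feasible i (ireg s' rJ). S \<union> T \<in> feasible (Suc 0) k) \<and>
      sum p S + opt p i (ireg s' rJ) = opt p (Suc 0) k \<and>
      (\<forall>v<n. imem s' (adr 0 v) = (if v \<in> S then 1 else 0))))"
  have step: "wp M trace_step (\<lambda>s u. \<exists>i'>i. I i' s u) s' (Suc u)"
    if i: "i \<le> n" and I: "I i s' u" for i s' u
  proof -
    define v where "v = ord i"
    define j where "j = ireg s' rJ"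
    have i0: "0 < i" "regs_ok s'" "ireg s' rV = v" "rmem s' = rmem s" "j \<le> k"
      using I unfolding I_def by (simp_all add: v_def j_def)
    have ai: "imem s' (adr 1 x) = imem s (adr 1 x)" "imem s' (adr 2 x) = imem s (adr 2 x)"
      if "x \<le> n" for x using I that unfolding I_def by simp_all
    have v: "v < n" unfolding v_def using i0(1) i by (rule ord_less)
    have hd: "imem s' (adr 1 v) = ord (Suc i)" and sk: "imem s' (adr 2 v) = skip v"
      using assms(2) i ai[of v] v unfolding threaded_def v_def by simp_all
    obtain q where q: "i < q" "q \<le> Suc n" "ord q = skip v"
      using ord_skip[OF i0(1) i] unfolding v_def by metis
    obtain S where S: "S \<subseteq> ord ` {0<..<i}" "\<forall>T\<in>feasible i j. S \<union> T \<in> feasible (Suc 0) k"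
      "sum p S + opt p i j = opt p (Suc 0) k"
      "\<forall>v<n. imem s' (adr 0 v) = (if v \<in> S then 1 else 0)"
      using I unfolding I_def j_def by blast
    have tv: "rmem s' (row v j) = opt p i j" and tx: "rmem s' (row (skip v) j) = opt p q j"
      using tab i0 i q unfolding v_def q(3)[symmetric, unfolded v_def] by simp_all
    have finS: "finite S" using S(1) by (rule finite_subset) simp
    have vS: "v \<notin> S"
    proof -
      have "ord i \<notin> ord ` {0<..<i}" using i i0(1) by (subst ord_mem_iff) auto
      then show ?thesis using S(1) unfolding v_def by blast
    qed
    have u: "u + 17 \<le> t + 3 + 17 * i" using I unfolding I_def by simp
    show ?thesis
    proof (rule wp_mono[OF wp_trace_step[OF i0(2,3) v j_def[symmetric] i0(5) hd sk skip_le[OF less_imp_le[OF v]]]])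
      fix s2 u2
      assume "regs_ok s2 \<and> rmem s2 = rmem s' \<and> u2 \<le> Suc u + 16 \<and>
        (if rmem s' (row (skip v) j) < rmem s' (row v j)
         then ireg s2 rV = ord (Suc i) \<and> ireg s2 rJ = j - 1 \<and> imem s2 = (imem s')(adr 0 v := 1)
         else ireg s2 rV = skip v \<and> ireg s2 rJ = j \<and> imem s2 = imem s')"
      then have s2: "regs_ok s2" "rmem s2 = rmem s" "u2 \<le> u + 17"
        and "if opt p q j < opt p i j
         then ireg s2 rV = ord (Suc i) \<and> ireg s2 rJ = j - 1 \<and> imem s2 = (imem s')(adr 0 v := 1)
         else ireg s2 rV = skip v \<and> ireg s2 rJ = j \<and> imem s2 = imem s'"
        using i0(4) unfolding tv tx by simp_all
      then consider
        (take) "opt p q j < opt p i j" "ireg s2 rV = ord (Suc i)" "ireg s2 rJ = j - 1"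
          "imem s2 = (imem s')(adr 0 v := 1)" |
        (skip) "opt p i j \<le> opt p q j" "ireg s2 rV = skip v" "ireg s2 rJ = j" "imem s2 = imem s'"
        by (meson not_less)
      then show "\<exists>i'>i. I i' s2 u2"
      proof cases
        case take
        \<comment> \<open>A strict inequality excludes budget 0, where both entries are 0, and
          forces the maximum in \<open>opt_Suc\<close> to be its first argument.\<close>
        obtain j' where j': "j = Suc j'"
          using take(1) by (cases j) (simp_all add: opt_0)
        have opt: "opt p i j = opt p (Suc i) j' + p v"
          using take(1) opt_Suc[OF i0(1) i _ q(2), of p j'] q i0(1)
          unfolding j' v_def by (simp add: max_def split: if_splits)
        have "I (Suc i) s2 u2"
          unfolding I_def
        proof (intro conjI exI[of _ "insert v S"])
          show "insert v S \<subseteq> ord ` {0<..<Suc i}"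
            using S(1) i0(1) unfolding v_def by (fastforce simp: less_Suc_eq)
          show "\<forall>T\<in>feasible (Suc i) (ireg s2 rJ). insert v S \<union> T \<in> feasible (Suc 0) k"
          proof
            fix T assume "T \<in> feasible (Suc i) (ireg s2 rJ)"
            then have "insert v T \<in> feasible i j"
              using feasible_take(1)[OF i0(1) i, of T j'] take(3) unfolding j' v_def by simp
            then have "S \<union> insert v T \<in> feasible (Suc 0) k" using S(2) by blast
            then show "insert v S \<union> T \<in> feasible (Suc 0) k" by simp
          qed
          show "sum p (insert v S) + opt p (Suc i) (ireg s2 rJ) = opt p (Suc 0) k"
            using S(3) opt finS vS take(3) j' by simp
          show "\<forall>l<n. imem s2 (adr 0 l) = (if l \<in> insert v S then 1 else 0)"
            using S(4) v take(4) by simp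
          show "\<forall>l\<le>n. imem s2 (adr 1 l) = imem s (adr 1 l) \<and> imem s2 (adr 2 l) = imem s (adr 2 l)"
            using ai v take(4) by simp
        qed (use s2 take(2,3) i i0 u in simp_all)
        then show ?thesis by blast
      next
        case skip
        \<comment> \<open>The recurrence gives the converse inequality, so refusing the subtree
          loses nothing.\<close>
        have "opt p q j \<le> opt p i j"
        proof (cases j)
          case (Suc j')
          then show ?thesis using opt_Suc[OF i0(1) i _ q(2), of p j'] q i0(1) unfolding v_def by simp
        qed (simp add: opt_0)
        then have opt: "opt p q j = opt p i j" using skip(1) by simp
        have "I q s2 u2"
          unfolding I_def
        proof (intro conjI exI[of _ S])
          have "{0<..<i} \<subseteq> {0<..<q}" using q(1) by auto
          then show "S \<subseteq> ord ` {0<..<q}" using S(1) by blast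
          show "\<forall>T\<in>feasible q (ireg s2 rJ). S \<union> T \<in> feasible (Suc 0) k"
            using S(2) feasible_skip[OF i0(1) i _ q(2)] q(1,3) unfolding v_def skip(3) by simp
          show "sum p S + opt p q (ireg s2 rJ) = opt p (Suc 0) k"
            using S(3) opt skip(3) by simp
          show "\<forall>l<n. imem s2 (adr 0 l) = (if l \<in> S then 1 else 0)"
            using S(4) skip(4) by simp
          show "\<forall>l\<le>n. imem s2 (adr 1 l) = imem s (adr 1 l) \<and> imem s2 (adr 2 l) = imem s (adr 2 l)"
            using ai skip(4) by simp
        qed (use s2 skip(2,3) q i0 u in simp_all)
        then show ?thesis using q(1) by blast
      qed
    qed
  qed
  \<comment> \<open>Among positions 1 to \<open>Suc n\<close> only the last has value
    \<open>n\<close>, so the loop test decides whether \<open>i \<le> n\<close>.\<close>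
  have less: "i \<le> n" if "I i s' u" "ireg s' rV < n" for i s' u
    using that ord_end unfolding I_def by (metis le_SucE less_irrefl)
  have stop: "i = Suc n" if "I i s' u" "\<not> ireg s' rV < n" for i s' u
    using that ord_less[of i] unfolding I_def by (metis le_SucE)
  have hd: "imem s (adr (Suc 0) n) = ord (Suc 0)"
    using assms(2) ord_0 unfolding threaded_def by (metis One_nat_def zero_le)
  have init: "I (Suc 0) s' (Suc (Suc (Suc t)))"
    if "regs_ok s'" "rmem s' = rmem s" "imem s' = imem s" "ireg s' rV = ord (Suc 0)" "ireg s' rJ = k" for s'
    unfolding I_def using that assms(3) by (simp add: exI[of _ "{}"])
  show ?thesis
    unfolding trace_back_def
    apply (simp add: run assms(1) hd)
    apply (rule wp_While[where I = I and i = "Suc 0" and N = "Suc n"])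
      apply (rule init; simp add: assms(1))
     apply (rule conjI)
    subgoal for i s u using less[of i s u] by (simp add: I_def)
    subgoal for i s u using less[of i s u] by (intro step) (simp_all add: I_def)
    subgoal premises prems for i s u
    proof -
      have "i = Suc n" using stop[OF prems(1)] prems(2,1) by (simp add: I_def)
      then show ?thesis
        using prems(1) unfolding I_def by (auto simp: feasible_end opt_end)
    qed
    done
qed

section \<open>The whole program\<close>

lemma wp_knapsack:
  "wp M knapsack (\<lambda>s u. u \<le> 29 + 70 * n + 10 * (n * k) \<and>
    (\<exists>S\<in>feasible (Suc 0) k. sum p S = opt p (Suc 0) k \<and>
      (\<forall>v<n. imem s (adr 0 v) = (if v \<in> S then 1 else 0)))) (input_state n par p k) 0"
proof -
  let ?s = "input_state n par p k"
  have par: "imem ?s (adr 0 v) = parent v" if "v < n" for v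
    using that by (simp add: input_state_def adr_def parent_def)
  have prof: "rmem ?s v = p v" if "v < n" for v
    using that by (simp add: input_state_def)
  have zero: "rmem ?s (row v j) = 0" for v j
    by (simp add: input_state_def row_def)
  show ?thesis
    unfolding knapsack_def wp_Seq
    apply (rule wp_mono[OF wp_init_regs])
       apply (simp_all add: input_state_def)[3]
    subgoal for s1 t1
    apply (rule wp_mono[OF wp_clear_heads], simp)
    subgoal for s2 t2
    apply (rule wp_mono[OF wp_build_lists], simp, simp add: par, simp, simp)
    subgoal for s3 t3
    apply (rule wp_mono[OF wp_thread], simp, simp, simp, simp, simp)
    subgoal for s4 t4
    apply (rule wp_mono[OF wp_fill_table], simp, simp, simp add: prof, simp add: zero)
    subgoal for s5 t5
    apply (rule wp_mono[OF wp_clear_output], simp)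
    subgoal for s6 t6
    apply (rule wp_mono[OF wp_trace_back], simp)
       apply (simp add: threaded_def ord_le)
      apply simp
     apply simp
    \<comment> \<open>The phases add up to 5+6+2+5+4+3+4 = 29 and, per node, 4+10+20+15+4+17 = 70;
      only the table contributes \<open>n * k\<close>.\<close>
    apply (simp add: algebra_simps)
    done done done done done done done
qed

end

theorem theorem1:
  "\<exists>(c :: prog) (C :: nat).
     \<forall>(n :: nat) (k :: nat) (par :: nat \<Rightarrow> nat option) (p :: nat \<Rightarrow> real).
       n \<ge> 1 \<and> k \<ge> 1 \<and> rooted_forest n par \<longrightarrow>
       (\<exists>t s T. runs (C * (n * k)) c (input_state n par p k) t s \<and>
                t \<le> C * (n * k) \<and>
                represents_set n s T \<and>
                max_profit_placement n par p k T)"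
proof (rule exI[of _ knapsack], rule exI[of _ 110], intro allI impI)
  fix n k :: nat and par :: "nat \<Rightarrow> nat option" and p :: "nat \<Rightarrow> real"
  assume A: "n \<ge> 1 \<and> k \<ge> 1 \<and> rooted_forest n par"
  have nk: "n \<le> n * k" "k \<le> n * k" "1 \<le> n * k" using A by auto
  \<comment> \<open>As 1, \<open>n\<close> and \<open>k\<close> are at most \<open>n * k\<close>,
    the time is at most 29+70+10 = 109 times \<open>n * k\<close>, the real cells 6 times and the
    integer cells 8 times; 110 covers all, also the strict bound.\<close>
  interpret tree_knapsack n par p k "110 * (n * k)"
  proof
    have "(n + 1) * (k + 2) = n * k + 2 * n + k + 2" by simp
    then show "(n + 1) * (k + 2) < 110 * (n * k)" using nk by linarith
    have "4 * (n + 1) \<le> 110 * m" if "n \<le> m" "1 \<le> m" for m :: nat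
      using that by simp
    then show "4 * (n + 1) \<le> 110 * (n * k)" using nk by blast
  qed (use A in simp)
  obtain t s S where run: "runs (110 * (n * k)) knapsack (input_state n par p k) t s"
    "t \<le> 29 + 70 * n + 10 * (n * k)" "S \<in> feasible (Suc 0) k" "sum p S = opt p (Suc 0) k"
    "\<forall>v<n. imem s (adr 0 v) = (if v \<in> S then 1 else 0)"
    using wp_knapsack unfolding wp_def by auto
  have "t \<le> 110 * (n * k)" using run(2) nk by linarith
  moreover have "max_profit_placement n par p k S"
    using run(3,4) opt_ge[of _ "Suc 0" k p] by (simp add: max_profit_placement_def feasible_1)
  moreover have "represents_set n s S"
    using run(3,5) by (simp add: represents_set_def feasible_1 parent_closed_def adr_def)
  ultimately show "\<exists>t s T. runs (110 * (n * k)) knapsack (input_state n par p k) t s \<and>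
      t \<le> 110 * (n * k) \<and> represents_set n s T \<and> max_profit_placement n par p k T"
    using run(1) by blast
qed

end
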